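(* Let $S$ be a Noetherian domain with quotient field $K$, let $\mathfrak{a}_\bullet$ be a graded family of ideals in $S$, and let $\mathfrak{b}_\bullet$ be a filtration of ideals in $S$. For $n\ge1$, set $\beta_n=\beta_n(\mathfrak{a}_\bullet,\mathfrak{b}_\bullet)$, $\overline{\beta_n}=\beta_n(\mathfrak{a}_\bullet,\overline{\mathfrak{b}_\bullet})$, and for any valuation $v$ of $K$, set $\beta_n^v=\beta_n^v(\mathfrak{a}_\bullet,\mathfrak{b}_\bullet)$. Suppose that $\mathcal{R}^{[k]}(\mathfrak{b}_\bullet)$ is a standard graded $S$-algebra and $\mathcal{R}(\overline{\mathfrak{b}_k^\bullet})$ is a finitely generated $\mathcal{R}(\mathfrak{b}_k^\bullet)$-module, for some $k\in\mathbb{N}$. Then there exists a valuation $v_0$ of $K$ (which can be chosen as a Rees valuation of $\mathfrak{b}_k$) such that $$\frac{1}{\widehat{\rho}(\mathfrak{a}_\bullet,\overline{\mathfrak{b}_\bullet})}=\lim_{n\to\infty}\frac{\beta_n}{n}=\lim_{n\to\infty}\frac{\overline{\beta_n}}{n}=\lim_{n\to\infty}\frac{\beta_n^{v_0}}{n}.$$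
   Context: $\mathbb{N}$ denotes the positive integers. A graded family of ideals in $S$ is a collection $\mathfrak{a}_\bullet=\{\mathfrak{a}_i\}_{i\ge 1}$ of ideals with $\mathfrak{a}_p\mathfrak{a}_q\subseteq\mathfrak{a}_{p+q}$ for all $p,q\ge 1$ (convention: $\mathfrak{a}_0=S$). It is a filtration if in addition $\mathfrak{a}_p\supseteq\mathfrak{a}_{p+1}$ for all $p\ge1$. $\overline{\mathfrak{b}_\bullet}=\{\overline{\mathfrak{b}_i}\}_{i\ge1}$ is the family of integral closures; $\mathfrak{b}_k^\bullet=\{\mathfrak{b}_k^i\}_{i\ge1}$ and $\overline{\mathfrak{b}_k^\bullet}=\{\overline{\mathfrak{b}_k^i}\}_{i\ge1}$. The Rees algebra is $\mathcal{R}(\mathfrak{a}_\bullet)=\bigoplus_{n\ge0}\mathfrak{a}_nt^n\subseteq S[t]$, and its $k$-th Veronese subalgebra is $\mathcal{R}^{[k]}(\mathfrak{a}_\bullet)=\bigoplus_{n\ge0}\mathfrak{a}_{kn}t^{kn}$; the latter is standard graded if generated over $S$ by $\mathfrak{a}_kt^k$, i.e. $\mathfrak{a}_{kn}=\mathfrak{a}_k^n$ for all $n\ge1$. The asymptotic resurgence number is $$\widehat{\rho}(\mathfrak{a}_\bullet,\mathfrak{b}_\bullet)=\sup\left\{\tfrac{s}{r} \mid s,r\in\mathbb{N},\ \mathfrak{a}_{st}\not\subseteq\mathfrak{b}_{rt}\text{ for all sufficiently large } t\right\},$$ with values in the extended reals and $\sup\varnothing=-\infty$; $1/\infty=0$.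 A valuation of $K$ is a function $v:K\setminus\{0\}\to\mathbb{Z}$ with $v(xy)=v(x)+v(y)$ and $v(x+y)\ge\min\{v(x),v(y)\}$ (when $x+y\ne0$); for an ideal $I\subseteq S$, $v(I)=\min\{v(x)\mid x\in I\setminus\{0\}\}$. Define $$\beta_n(\mathfrak{a}_\bullet,\mathfrak{b}_\bullet)=\inf\{d\in\mathbb{N}\mid\mathfrak{a}_n\not\subseteq\mathfrak{b}_d\},\qquad \beta_n^v(\mathfrak{a}_\bullet,\mathfrak{b}_\bullet)=\inf\{d\in\mathbb{N}\mid v(\mathfrak{a}_n)<v(\mathfrak{b}_d)\},$$ with $\inf\varnothing=\infty$. For an ideal $I\subseteq S$, the Rees valuation rings of $I$ are the members of the (finite) minimal set $\{V_1,\dots,V_r\}$ of discrete valuation rings with $S\subseteq V_i\subseteq K$ and $\overline{I^n}=\bigcap_{i=1}^r (I^nV_i\cap S)$ for all $n\in\mathbb{N}$; the corresponding valuations are the Rees valuations of $I$.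
   Formalization: It is assumed that a_n is nonzero for all large n and that b_k is a proper ideal (otherwise the equalities fail); the choice of v_0 as a Rees valuation of b_k is claimed only when b_k is nonzero, as Rees valuations of the zero ideal are not well defined. *)

theory Defs
  imports Complex_Main
    "HOL-Library.Extended_Real"
    "HOL-Computational_Algebra.Polynomial"
    "HOL-Computational_Algebra.Polynomial_Factorial"
    "HOL-Computational_Algebra.Fraction_Field"
begin

text \<open>
  The domain \<open>S\<close> is the type \<open>'a :: idom\<close>, its quotient field \<open>K\<close> is \<open>'a fract\<close> and \<open>S[t]\<close> is
  \<open>'a poly\<close>. Ideals are the submodules of the ring regarded as a module over itself.
\<close>

subsection \<open>Ideals\<close>

lemma module_times: "module ((*) :: 'a::comm_ring_1 \<Rightarrow> 'a \<Rightarrow> 'a)"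
  by unfold_locales (simp_all add: algebra_simps)

abbreviation is_ideal :: "'a::comm_ring_1 set \<Rightarrow> bool"
  where "is_ideal \<equiv> module.subspace (*)"

abbreviation ideal_gen :: "'a::comm_ring_1 set \<Rightarrow> 'a set"
  where "ideal_gen \<equiv> module.span (*)"

definition noetherian :: "'a::comm_ring_1 itself \<Rightarrow> bool"
  where "noetherian _ \<longleftrightarrow> (\<forall>I :: 'a set. is_ideal I \<longrightarrow> (\<exists>F. finite F \<and> I = ideal_gen F))"

definition ideal_mult :: "'a::comm_ring_1 set \<Rightarrow> 'a set \<Rightarrow> 'a set"
  where "ideal_mult I J = ideal_gen {x * y | x y. x \<in> I \<and> y \<in> J}"

primrec ideal_pow :: "'a::comm_ring_1 set \<Rightarrow> nat \<Rightarrow> 'a set"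
  where
    "ideal_pow I 0 = UNIV"
  | "ideal_pow I (Suc n) = ideal_mult I (ideal_pow I n)"

definition ideal_integral_closure :: "'a::comm_ring_1 set \<Rightarrow> 'a set"
  where "ideal_integral_closure I =
    {x. \<exists>n\<ge>1. \<exists>c. (\<forall>i\<in>{1..n}. c i \<in> ideal_pow I i) \<and> x ^ n + (\<Sum>i=1..n. c i * x ^ (n - i)) = 0}"


subsection \<open>Graded families and Rees algebras\<close>

text \<open>Families are indexed by all of \<open>nat\<close>; the entry at \<open>0\<close> is fixed by the convention
  \<open>a 0 = S\<close>.\<close>

definition graded_family :: "(nat \<Rightarrow> 'a::comm_ring_1 set) \<Rightarrow> bool"
  where "graded_family a \<longleftrightarrow>
    a 0 = UNIV \<and> (\<forall>n\<ge>1. is_ideal (a n)) \<and>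
    (\<forall>p\<ge>1. \<forall>q\<ge>1. ideal_mult (a p) (a q) \<subseteq> a (p + q))"

definition filtration :: "(nat \<Rightarrow> 'a::comm_ring_1 set) \<Rightarrow> bool"
  where "filtration a \<longleftrightarrow> graded_family a \<and> (\<forall>p\<ge>1. a (p + 1) \<subseteq> a p)"

definition closure_family :: "(nat \<Rightarrow> 'a::comm_ring_1 set) \<Rightarrow> nat \<Rightarrow> 'a set"
  where "closure_family b = (\<lambda>i. ideal_integral_closure (b i))"

definition rees_algebra :: "(nat \<Rightarrow> 'a::comm_ring_1 set) \<Rightarrow> 'a poly set"
  where "rees_algebra a = {p. \<forall>n. coeff p n \<in> a n}"

definition veronese :: "nat \<Rightarrow> (nat \<Rightarrow> 'a::comm_ring_1 set) \<Rightarrow> 'a poly set"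
  where "veronese k a = {p. \<forall>n. coeff p n \<in> (if k dvd n then a n else {0})}"

text \<open>The \<open>S\<close>-subalgebra of \<open>S[t]\<close> generated by \<open>X\<close>.\<close>

inductive_set subalgebra_gen :: "'a::comm_ring_1 poly set \<Rightarrow> 'a poly set" for X
  where
    const: "[:c:] \<in> subalgebra_gen X"
  | base: "p \<in> X \<Longrightarrow> p \<in> subalgebra_gen X"
  | add: "p \<in> subalgebra_gen X \<Longrightarrow> q \<in> subalgebra_gen X \<Longrightarrow> p + q \<in> subalgebra_gen X"
  | mult: "p \<in> subalgebra_gen X \<Longrightarrow> q \<in> subalgebra_gen X \<Longrightarrow> p * q \<in> subalgebra_gen X"

definition veronese_standard_graded :: "nat \<Rightarrow> (nat \<Rightarrow> 'a::comm_ring_1 set) \<Rightarrow> bool"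
  where "veronese_standard_graded k a \<longleftrightarrow>
    veronese k a = subalgebra_gen {Polynomial.monom c k | c. c \<in> a k}"

text \<open>\<open>M\<close> is finitely generated over the subring \<open>R\<close> of a common ambient ring.\<close>

definition finitely_generated_module :: "'b::comm_ring_1 set \<Rightarrow> 'b set \<Rightarrow> bool"
  where "finitely_generated_module R M \<longleftrightarrow>
    (\<exists>G. finite G \<and> M = {\<Sum>g\<in>G. c g * g | c. \<forall>g\<in>G. c g \<in> R})"


subsection \<open>Valuations and Rees valuations\<close>

text \<open>Valuations are defined on \<open>K - {0}\<close>; the value at \<open>0\<close> is irrelevant and never used.\<close>

definition valuation :: "('k::field \<Rightarrow> int) \<Rightarrow> bool"
  where "valuation v \<longleftrightarrow>
    (\<forall>x y. x \<noteq> 0 \<longrightarrow> y \<noteq> 0 \<longrightarrow> v (x * y) = v x + v y) \<and>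
    (\<forall>x y. x \<noteq> 0 \<longrightarrow> y \<noteq> 0 \<longrightarrow> x + y \<noteq> 0 \<longrightarrow> v (x + y) \<ge> min (v x) (v y))"

definition valuation_ring :: "('k::field \<Rightarrow> int) \<Rightarrow> 'k set"
  where "valuation_ring v = {x. x = 0 \<or> v x \<ge> 0}"

definition normalized_valuation :: "('k::field \<Rightarrow> int) \<Rightarrow> bool"
  where "normalized_valuation v \<longleftrightarrow> valuation v \<and> v ` (- {0}) = UNIV"

text \<open>Discrete valuation rings with quotient field \<open>K\<close>.\<close>

definition dvr_of_field :: "'k::field set \<Rightarrow> bool"
  where "dvr_of_field V \<longleftrightarrow> (\<exists>v. normalized_valuation v \<and> V = valuation_ring v)"

text \<open>The extension \<open>I V\<close> of an ideal \<open>I\<close> of \<open>S\<close> to an overring \<open>V\<close> inside \<open>K\<close>.\<close>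

definition ideal_extension :: "'a::idom set \<Rightarrow> 'a fract set \<Rightarrow> 'a fract set"
  where "ideal_extension I V =
    {\<Sum>x\<in>F. to_fract x * c x | F c. finite F \<and> F \<subseteq> I \<and> (\<forall>x\<in>F. c x \<in> V)}"

definition represents_closures :: "'a::idom set \<Rightarrow> 'a fract set set \<Rightarrow> bool"
  where "represents_closures I \<V> \<longleftrightarrow>
    finite \<V> \<and> (\<forall>V\<in>\<V>. dvr_of_field V \<and> range to_fract \<subseteq> V) \<and>
    (\<forall>n\<ge>1. ideal_integral_closure (ideal_pow I n) =
      (\<Inter>V\<in>\<V>. {x. to_fract x \<in> ideal_extension (ideal_pow I n) V}))"

definition rees_valuation_rings :: "'a::idom set \<Rightarrow> 'a fract set set \<Rightarrow> bool"
  where "rees_valuation_rings I \<V> \<longleftrightarrow>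
    represents_closures I \<V> \<and> (\<forall>\<W>. \<W> \<subset> \<V> \<longrightarrow> \<not> represents_closures I \<W>)"

definition rees_valuation :: "'a::idom set \<Rightarrow> ('a fract \<Rightarrow> int) \<Rightarrow> bool"
  where "rees_valuation I v \<longleftrightarrow>
    normalized_valuation v \<and> (\<exists>\<V>. rees_valuation_rings I \<V> \<and> valuation_ring v \<in> \<V>)"

text \<open>The infimum is the minimum whenever \<open>v\<close> is bounded below on a nonzero ideal \<open>I\<close>;
  for the zero ideal it is \<open>\<infinity>\<close>.\<close>

definition ideal_value :: "('a::idom fract \<Rightarrow> int) \<Rightarrow> 'a set \<Rightarrow> ereal"
  where "ideal_value v I = (INF x\<in>I - {0}. ereal (real_of_int (v (to_fract x))))"


subsection \<open>Asymptotic resurgence and the numbers beta\<close>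

text \<open>In \<open>ereal\<close>, \<open>Sup {} = - \<infinity>\<close> and \<open>Inf {} = \<infinity>\<close>.\<close>

definition asymptotic_resurgence ::
    "(nat \<Rightarrow> 'a set) \<Rightarrow> (nat \<Rightarrow> 'a set) \<Rightarrow> ereal"
  where "asymptotic_resurgence a b =
    Sup {ereal (real s / real r) | s r. s \<ge> 1 \<and> r \<ge> 1 \<and>
      (\<forall>\<^sub>F t in sequentially. \<not> a (s * t) \<subseteq> b (r * t))}"

definition beta :: "(nat \<Rightarrow> 'a set) \<Rightarrow> (nat \<Rightarrow> 'a set) \<Rightarrow> nat \<Rightarrow> ereal"
  where "beta a b n = (INF d\<in>{d. d \<ge> 1 \<and> \<not> a n \<subseteq> b d}. ereal (real d))"

definition beta_val ::
    "('a::idom fract \<Rightarrow> int) \<Rightarrow> (nat \<Rightarrow> 'a set) \<Rightarrow> (nat \<Rightarrow> 'a set) \<Rightarrow> nat \<Rightarrow> ereal"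
  where "beta_val v a b n =
    (INF d\<in>{d. d \<ge> 1 \<and> ideal_value v (a n) < ideal_value v (b d)}. ereal (real d))"

end

(*
  Put I = b k. The ring B, the direct sum over all integers n of the integral closures of I^n times t^n
  (with I^n = S for n <= 0), is noetherian by the finiteness hypothesis and integrally closed in
  S[t, 1/t]. Let u = 1/t. For a homogeneous associated prime P of uB, the annihilator of the class of some
  g = x t^n, the element g/u does not map P into P, since it would then be integral over B; hence P is
  invertible after localization and B_P is a discrete valuation ring. As g/u has order -1 there, the P-adic
  order of f is the number of times that f can be multiplied by g/u without leaving B. There are
  finitely many such P, and uB is cut out by their orders, so the restrictions of these orders to K
  represent the integral closures of the powers of I; a minimal subfamily consists of Rees valuations.

  For these valuations v, v(a n)/n converges by subadditivity. The integral closure of I^m is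
  {f. v(f) >= m v(I) for all v}, and integral closures of I^(m + c) lie in I^m for a constant c, again by
  the finiteness hypothesis. Hence the three sequences beta n all differ from k min_v v(a n)/v(I), or from
  its value at the v for which lim v(a n)/(n v(I)) is smallest, by o(n).
*)

theory Submission
  imports Defs
begin

subsection \<open>Ideals, powers and integral closures\<close>

text \<open>Integral dependence enters mainly through almost integrality: over a noetherian domain,
  x is in the closure of I^n, for I nonzero, iff some nonzero z has z x^l in I^(n l) for all l. This
  makes closures stable under sums and products, and valuations are compared by letting l grow.
  Localizations are avoided: y t^m lies in P iff x y lies one step deeper in the filtration than its
  degree demands. The order is additive because, once powers of g/u lead out of B, they never lead
  back; this rests on an element y of P with (g/u) y in B but outside P. The constant c is the
  largest degree of a module generator and serves twice: multiplication by a^c, for a nonzero a in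
  I, maps closures into powers and so carries the chain condition over from the Rees algebra; and a
  n in the closure of I^(m + c) gives a n in I^m, which bounds \<open>beta a b n\<close> from
  below.\<close>

lemmas ideal_0 = module.subspace_0[OF module_times]
  and ideal_add = module.subspace_add[OF module_times]
  and ideal_mult_left = module.subspace_scale[OF module_times]
  and ideal_diff = module.subspace_diff[OF module_times]
  and ideal_neg = module.subspace_neg[OF module_times]
  and ideal_sum = module.subspace_sum[OF module_times]
  and ideal_UNIV = module.subspace_UNIV[OF module_times]
  and ideal_gen_base = module.span_base[OF module_times]
  and ideal_gen_ideal = module.subspace_span[OF module_times]
  and ideal_gen_minimal = module.span_minimal[OF module_times]

lemma idealI:
  fixes A :: "'a::comm_ring_1 set"
  assumes "0 \<in> A" "\<And>x y. x \<in> A \<Longrightarrow> y \<in> A \<Longrightarrow> x + y \<in> A" "\<And>c x. x \<in> A \<Longrightarrow> c * x \<in> A"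
  shows "is_ideal A"
  using assms by (intro module.subspaceI[OF module_times])

lemma ideal_mult_right:
  fixes A :: "'a::comm_ring_1 set"
  shows "is_ideal A \<Longrightarrow> x \<in> A \<Longrightarrow> x * c \<in> A"
  using ideal_mult_left[of A x c] by (simp add: mult.commute)

lemma mult_in_ideal_mult: "x \<in> A \<Longrightarrow> y \<in> B \<Longrightarrow> x * y \<in> ideal_mult A B"
  unfolding ideal_mult_def by (rule ideal_gen_base) blast

lemma ideal_ideal_mult: "is_ideal (ideal_mult A B)"
  unfolding ideal_mult_def by (rule ideal_gen_ideal)

lemma ideal_mult_minimal:
  assumes "is_ideal C" "\<And>x y. x \<in> A \<Longrightarrow> y \<in> B \<Longrightarrow> x * y \<in> C"
  shows "ideal_mult A B \<subseteq> C"
  unfolding ideal_mult_def using assms by (intro ideal_gen_minimal) blast+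

lemma ideal_ideal_pow: "is_ideal (ideal_pow A n)"
  by (cases n) (simp_all add: ideal_UNIV ideal_ideal_mult)

lemma ideal_pow_mono: "A \<subseteq> B \<Longrightarrow> ideal_pow A n \<subseteq> ideal_pow B n"
proof (induction n)
  case (Suc n)
  then show ?case
    unfolding ideal_pow.simps by (intro ideal_mult_minimal ideal_ideal_mult mult_in_ideal_mult) auto
qed simp

lemma ideal_pow_1:
  assumes "is_ideal A"
  shows "ideal_pow A 1 = A"
proof
  show "ideal_pow A 1 \<subseteq> A"
    using ideal_mult_minimal[of A A UNIV] ideal_mult_right assms by auto
  show "A \<subseteq> ideal_pow A 1"
    using mult_in_ideal_mult[of _ A 1 UNIV] by auto
qed

text \<open>For fixed \<open>y\<close> the elements \<open>x\<close> with \<open>x * y\<close> in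
  the target form an ideal, so testing products of generators is enough. Such colon ideals replace
  explicit finite sums here and in later span arguments.\<close>

lemma ideal_pow_add_mem: "x \<in> ideal_pow A m \<Longrightarrow> y \<in> ideal_pow A n \<Longrightarrow> x * y \<in> ideal_pow A (m + n)"
proof (induction m arbitrary: x)
  case 0
  then show ?case using ideal_mult_left[OF ideal_ideal_pow] by auto
next
  case (Suc m)
  have "ideal_mult A (ideal_pow A m) \<subseteq> {x. x * y \<in> ideal_pow A (Suc m + n)}"
  proof (rule ideal_mult_minimal)
    show "is_ideal {x. x * y \<in> ideal_pow A (Suc m + n)}"
      using ideal_ideal_pow[of A "Suc m + n"]
      by (intro idealI) (auto simp: ideal_0 distrib_right ideal_add mult.assoc ideal_mult_left)
    show "u * v \<in> {x. x * y \<in> ideal_pow A (Suc m + n)}" if "u \<in> A" "v \<in> ideal_pow A m" for u v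
      using that Suc by (auto simp: mult.assoc intro!: mult_in_ideal_mult)
  qed
  then show ?case using Suc.prems by auto
qed

lemma ideal_pow_add_minimal:
  assumes "is_ideal C" "\<And>x y. x \<in> ideal_pow A m \<Longrightarrow> y \<in> ideal_pow A n \<Longrightarrow> x * y \<in> C"
  shows "ideal_pow A (m + n) \<subseteq> C"
  using assms
proof (induction m arbitrary: C)
  case 0
  show ?case using "0.prems"(2)[of 1] by auto
next
  case (Suc m)
  have "u * v \<in> C" if "u \<in> A" "v \<in> ideal_pow A (m + n)" for u v
  proof -
    have "ideal_pow A (m + n) \<subseteq> {v. u * v \<in> C}"
    proof (rule Suc.IH)
      show "is_ideal {v. u * v \<in> C}"
        using Suc.prems(1)
        by (intro idealI) (auto simp: ideal_0 distrib_left ideal_add mult.left_commute ideal_mult_left)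
      show "x * y \<in> {v. u * v \<in> C}" if "x \<in> ideal_pow A m" "y \<in> ideal_pow A n" for x y
        using Suc.prems(2)[of "u * x" y] that \<open>u \<in> A\<close> by (auto simp: mult.assoc mult_in_ideal_mult)
    qed
    then show ?thesis using that by auto
  qed
  then show ?case using ideal_mult_minimal[OF Suc.prems(1)] by simp
qed

lemma ideal_pow_antimono: "m \<le> n \<Longrightarrow> ideal_pow A n \<subseteq> ideal_pow A m"
  using ideal_pow_add_minimal[OF ideal_ideal_pow[of A m], of A m "n - m"]
  by (simp add: ideal_mult_right ideal_ideal_pow)

lemma ideal_pow_pow: "ideal_pow (ideal_pow A n) i = ideal_pow A (n * i)"
proof (induction i)
  case (Suc i)
  have "ideal_mult (ideal_pow A n) (ideal_pow A (n * i)) \<subseteq> ideal_pow A (n + n * i)"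
    by (intro ideal_mult_minimal ideal_ideal_pow ideal_pow_add_mem)
  moreover have "ideal_pow A (n + n * i) \<subseteq> ideal_mult (ideal_pow A n) (ideal_pow A (n * i))"
    by (intro ideal_pow_add_minimal ideal_ideal_mult mult_in_ideal_mult)
  ultimately show ?case using Suc by auto
qed simp

lemma power_in_ideal_pow: "x \<in> A \<Longrightarrow> x ^ n \<in> ideal_pow A n"
  by (induction n) (auto intro: mult_in_ideal_mult)

lemma ideal_nonzero_mem:
  assumes "is_ideal A" "A \<noteq> {0}"
  obtains x where "x \<in> A" "x \<noteq> 0"
  using assms ideal_0[OF assms(1)] by blast

lemma ideal_integral_closure_mono:
  "A \<subseteq> B \<Longrightarrow> ideal_integral_closure A \<subseteq> ideal_integral_closure B"
  unfolding ideal_integral_closure_def using ideal_pow_mono[of A B] by blast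

lemma subset_ideal_integral_closure:
  assumes "is_ideal A"
  shows "A \<subseteq> ideal_integral_closure A"
proof
  fix x assume "x \<in> A"
  have "\<exists>c. (\<forall>i\<in>{1..1}. c i \<in> ideal_pow A i) \<and> x ^ 1 + (\<Sum>i=1..1. c i * x ^ (1 - i)) = 0"
    using \<open>x \<in> A\<close> ideal_pow_1[OF assms] ideal_neg[OF assms] by (intro exI[of _ "\<lambda>_. -x"]) simp
  then show "x \<in> ideal_integral_closure A"
    unfolding ideal_integral_closure_def by blast
qed

lemma ideal_integral_closure_zero:
  fixes A :: "'a::idom set"
  assumes "A = {0}"
  shows "ideal_integral_closure A = {0}"
proof -
  have z: "ideal_pow A i = {0}" if "i \<ge> 1" for i :: nat
  proof -
    obtain j where "i = Suc j" using \<open>i \<ge> 1\<close> by (cases i) simp_all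
    moreover have "ideal_mult {0} (ideal_pow {0} j) \<subseteq> {0 :: 'a}"
      by (rule ideal_mult_minimal[OF module.subspace_single_0[OF module_times]]) simp
    ultimately show ?thesis
      using assms ideal_0[OF ideal_ideal_pow[of A i]] by auto
  qed
  have "x = 0" if "x \<in> ideal_integral_closure A" for x
  proof -
    obtain n c where n: "n \<ge> 1" "\<forall>i\<in>{1..n}. c i \<in> ideal_pow A i" 
      "x ^ n + (\<Sum>i=1..n. c i * x ^ (n - i)) = 0"
      using \<open>x \<in> _\<close> unfolding ideal_integral_closure_def by blast
    have "(\<Sum>i=1..n. c i * x ^ (n - i)) = 0"
      using n z by (intro sum.neutral) auto
    then show ?thesis using n(3) by auto
  qed
  moreover have "0 \<in> ideal_integral_closure A"
    using subset_ideal_integral_closure[of A] assms module.subspace_single_0[OF module_times] by blast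
  ultimately show ?thesis by blast
qed

text \<open>The equation of degree N rewrites x^l, for l >= N, through the N preceding powers, with
  coefficients in the right powers of A. A denominator is thus only required for l < N, where c =
  a^(n N) is already in A^(n l).\<close>

lemma almost_integral_of_integral:
  fixes A :: "'a::idom set"
  assumes "is_ideal A" "A \<noteq> {0}" "x \<in> ideal_integral_closure (ideal_pow A n)"
  obtains c where "c \<noteq> 0" "\<And>l. c * x ^ l \<in> ideal_pow A (n * l)"
proof -
  obtain N f where N: "N \<ge> 1" "\<And>i. i \<in> {1..N} \<Longrightarrow> f i \<in> ideal_pow A (n * i)"
    and eq: "x ^ N + (\<Sum>i=1..N. f i * x ^ (N - i)) = 0"
    using assms(3) unfolding ideal_integral_closure_def ideal_pow_pow by blast
  obtain a where a: "a \<in> A" "a \<noteq> 0" using ideal_nonzero_mem assms by blast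
  define c where "c = a ^ (n * N)"
  have "c * x ^ l \<in> ideal_pow A (n * l)" for l
  proof (induction l rule: less_induct)
    case (less l)
    show ?case
    proof (cases "l < N")
      case True
      then have "c \<in> ideal_pow A (n * l)"
        unfolding c_def using a power_in_ideal_pow[of a A "n * N"]
          ideal_pow_antimono[of "n * l" "n * N" A] by auto
      then show ?thesis using ideal_mult_right[OF ideal_ideal_pow] by blast
    next
      case False
      have "c * x ^ l = c * x ^ (l - N) * x ^ N"
        using False by (simp add: mult.assoc flip: power_add)
      also have "x ^ N = - (\<Sum>i=1..N. f i * x ^ (N - i))" using eq by (simp add: eq_neg_iff_add_eq_0)
      also have "c * x ^ (l - N) * - (\<Sum>i=1..N. f i * x ^ (N - i)) =
        - (\<Sum>i=1..N. f i * (c * x ^ (l - i)))"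
        unfolding mult_minus_right sum_distrib_left neg_equal_iff_equal
      proof (rule sum.cong)
        fix i assume "i \<in> {1..N}"
        then have "x ^ (l - i) = x ^ (l - N) * x ^ (N - i)"
          using False by (simp flip: power_add)
        then show "c * x ^ (l - N) * (f i * x ^ (N - i)) = f i * (c * x ^ (l - i))"
          by (simp add: mult_ac)
      qed simp
      also have "\<dots> \<in> ideal_pow A (n * l)"
      proof (intro ideal_neg ideal_sum ideal_ideal_pow)
        fix i assume i: "i \<in> {1..N}"
        then have "c * x ^ (l - i) \<in> ideal_pow A (n * (l - i))"
          using less False by auto
        moreover have "n * i + n * (l - i) = n * l"
          using i False by (metis add_mult_distrib2 atLeastAtMost_iff le_add_diff_inverse le_trans linorder_not_less)
        ultimately show "f i * (c * x ^ (l - i)) \<in> ideal_pow A (n * l)"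
          using ideal_pow_add_mem[OF N(2)[OF i]] by metis
      qed
      finally show ?thesis .
    qed
  qed
  then show ?thesis using that[of c] a by (simp add: c_def)
qed

subsection \<open>Noetherian subrings and Hilbert's basis theorem\<close>

definition subring :: "'b::comm_ring_1 set \<Rightarrow> bool"
  where "subring R \<longleftrightarrow> 1 \<in> R \<and> (\<forall>x\<in>R. \<forall>y\<in>R. x - y \<in> R \<and> x * y \<in> R)"

definition ideal_in :: "'b::comm_ring_1 set \<Rightarrow> 'b set \<Rightarrow> bool"
  where "ideal_in R U \<longleftrightarrow> U \<subseteq> R \<and> 0 \<in> U \<and> (\<forall>x\<in>U. \<forall>y\<in>U. x + y \<in> U) \<and> (\<forall>r\<in>R. \<forall>x\<in>U. r * x \<in> U)"

text \<open>The chain condition refers to a subring of a fixed ring, so that generators can be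
  adjoined one after another inside \<open>'a poly\<close> without a change of type.\<close>

definition acc_subring :: "'b::comm_ring_1 set \<Rightarrow> bool"
  where "acc_subring R \<longleftrightarrow>
    (\<forall>U :: nat \<Rightarrow> 'b set. (\<forall>j. ideal_in R (U j) \<and> U j \<subseteq> U (Suc j)) \<longrightarrow> (\<exists>m. \<forall>j\<ge>m. U j = U m))"

definition adjoin :: "'b::comm_ring_1 set \<Rightarrow> 'b \<Rightarrow> 'b set"
  where "adjoin R y = {poly q y | q. \<forall>i. coeff q i \<in> R}"

lemma subringD:
  assumes "subring R"
  shows "1 \<in> R" "0 \<in> R" "x \<in> R \<Longrightarrow> y \<in> R \<Longrightarrow> x - y \<in> R" "x \<in> R \<Longrightarrow> y \<in> R \<Longrightarrow> x * y \<in> R"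
    "x \<in> R \<Longrightarrow> -x \<in> R" "x \<in> R \<Longrightarrow> y \<in> R \<Longrightarrow> x + y \<in> R"
proof -
  show *: "1 \<in> R" "\<And>x y. x \<in> R \<Longrightarrow> y \<in> R \<Longrightarrow> x - y \<in> R" "x \<in> R \<Longrightarrow> y \<in> R \<Longrightarrow> x * y \<in> R"
    using assms by (auto simp: subring_def)
  show **: "0 \<in> R" using *(2)[of 1 1] *(1) by simp
  show ***: "\<And>x. x \<in> R \<Longrightarrow> -x \<in> R" using *(2)[of 0] ** by simp
  show "x \<in> R \<Longrightarrow> y \<in> R \<Longrightarrow> x + y \<in> R" using *(2)[of x "-y"] ***[of y] by simp
qed

lemma subring_sum: "subring R \<Longrightarrow> (\<And>i. i \<in> A \<Longrightarrow> f i \<in> R) \<Longrightarrow> sum f A \<in> R"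
  by (induction A rule: infinite_finite_induct) (auto simp: subringD)

lemma ideal_inD:
  assumes "ideal_in R U"
  shows "U \<subseteq> R" "0 \<in> U" "x \<in> U \<Longrightarrow> y \<in> U \<Longrightarrow> x + y \<in> U" "r \<in> R \<Longrightarrow> x \<in> U \<Longrightarrow> r * x \<in> U"
  using assms by (auto simp: ideal_in_def)

lemma ideal_in_neg: "ideal_in R U \<Longrightarrow> subring R \<Longrightarrow> x \<in> U \<Longrightarrow> - x \<in> U"
  using ideal_inD(4)[of R U "-1" x] subringD[of R] by auto

lemma coeff_add_mult_in_subring:
  assumes "subring R" "\<forall>i. coeff p i \<in> R" "\<forall>i. coeff q i \<in> R"
  shows "coeff (p - q) i \<in> R" "coeff (p + q) i \<in> R" "coeff (p * q) i \<in> R"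
  using assms by (auto simp: coeff_mult subringD intro!: subring_sum)

lemma subring_adjoin:
  assumes "subring R"
  shows "subring (adjoin R y)"
  unfolding subring_def adjoin_def
proof (safe, goal_cases)
  case 1
  show ?case using subringD[OF assms] by (intro exI[of _ 1]) (auto simp: coeff_1)
next
  case (2 _ _ p q)
  then show ?case using assms by (intro exI[of _ "p - q"]) (auto simp: subringD)
next
  case (3 _ _ p q)
  then show ?case using coeff_add_mult_in_subring[OF assms] by (intro exI[of _ "p * q"]) auto
qed

lemma adjoin_superset: "subring R \<Longrightarrow> R \<subseteq> adjoin R y"
proof
  fix r assume "subring R" "r \<in> R"
  then show "r \<in> adjoin R y"
    unfolding adjoin_def by (auto intro!: exI[of _ "[:r:]"] simp: coeff_pCons subringD split: nat.splits)
qed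

lemma adjoin_generator: "subring R \<Longrightarrow> y \<in> adjoin R y"
  unfolding adjoin_def
  by (auto intro!: exI[of _ "[:0, 1:]"] simp: coeff_pCons subringD split: nat.splits)

text \<open>As \<open>y\<close> may satisfy relations over \<open>R\<close>, leading coefficients
  belong to representing polynomials and not to elements of R[y]. The coefficient at
  \<open>n\<close> may vanish, which makes each level an ideal.\<close>

definition leading_coeffs :: "'b::comm_ring_1 set \<Rightarrow> 'b \<Rightarrow> 'b set \<Rightarrow> nat \<Rightarrow> 'b set"
  where "leading_coeffs R y U n =
    {coeff q n | q. (\<forall>i. coeff q i \<in> R) \<and> (\<forall>i>n. coeff q i = 0) \<and> poly q y \<in> U}"

lemma leading_coeffs_ideal:
  assumes "subring R" "ideal_in (adjoin R y) U"
  shows "ideal_in R (leading_coeffs R y U n)"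
  unfolding ideal_in_def leading_coeffs_def
proof (safe, goal_cases)
  case 2
  show ?case using ideal_inD(2)[OF assms(2)] subringD[OF assms(1)] by (intro exI[of _ 0]) auto
next
  case (3 _ _ p q)
  then show ?case using ideal_inD[OF assms(2)] subringD[OF assms(1)] by (intro exI[of _ "p + q"]) auto
next
  case (4 r _ q)
  then show ?case
    using ideal_inD(4)[OF assms(2), of r] subringD[OF assms(1)] subsetD[OF adjoin_superset[OF assms(1)]]
    by (intro exI[of _ "smult r q"]) auto
qed auto

lemma leading_coeffs_Suc:
  assumes "subring R" "ideal_in (adjoin R y) U"
  shows "leading_coeffs R y U n \<subseteq> leading_coeffs R y U (Suc n)"
proof
  fix x assume "x \<in> leading_coeffs R y U n"
  then obtain q where q: "x = coeff q n" "\<forall>i. coeff q i \<in> R" "\<forall>i>n. coeff q i = 0" "poly q y \<in> U"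
    unfolding leading_coeffs_def by blast
  then show "x \<in> leading_coeffs R y U (Suc n)"
    unfolding leading_coeffs_def
    using ideal_inD(4)[OF assms(2) adjoin_generator[OF assms(1)]] subringD[OF assms(1)]
    by (auto intro!: exI[of _ "pCons 0 q"] simp: coeff_pCons split: nat.splits)
qed

lemma leading_coeffs_mono: "U \<subseteq> V \<Longrightarrow> leading_coeffs R y U n \<subseteq> leading_coeffs R y V n"
  unfolding leading_coeffs_def by blast

text \<open>Descent on the degree bound: the top coefficient of a polynomial representing an element
  of \<open>V\<close> is matched by one representing an element of \<open>U\<close>, and the
  difference has a smaller bound and still represents an element of \<open>V\<close>.\<close>

lemma leading_coeffs_determine:
  assumes R: "subring R" and U: "ideal_in (adjoin R y) U" and V: "ideal_in (adjoin R y) V"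
    and "U \<subseteq> V" and eq: "\<And>n. leading_coeffs R y U n = leading_coeffs R y V n"
  shows "U = V"
proof -
  have "poly q y \<in> U" if "\<forall>i. coeff q i \<in> R" "\<forall>i\<ge>n. coeff q i = 0" "poly q y \<in> V" for n q
    using that
  proof (induction n arbitrary: q)
    case 0
    then have "q = 0" by (simp add: poly_eq_iff)
    then show ?case using ideal_inD(2)[OF U] by simp
  next
    case (Suc n)
    have "coeff q n \<in> leading_coeffs R y V n"
      unfolding leading_coeffs_def using Suc.prems by auto
    then obtain p where p: "coeff p n = coeff q n" "\<forall>i. coeff p i \<in> R" "\<forall>i>n. coeff p i = 0" "poly p y \<in> U"
      unfolding eq[symmetric] unfolding leading_coeffs_def mem_Collect_eq by metis
    have "poly (q - p) y \<in> U"
    proof (rule Suc.IH)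
      show "\<forall>i. coeff (q - p) i \<in> R" using p Suc.prems R by (auto simp: subringD)
      show "\<forall>i\<ge>n. coeff (q - p) i = 0"
      proof (intro allI impI)
        fix i assume "i \<ge> n"
        then show "coeff (q - p) i = 0" using p Suc.prems(2) by (cases "i = n") auto
      qed
      show "poly (q - p) y \<in> V"
        using ideal_inD(3)[OF V, of "poly q y" "- poly p y"] ideal_in_neg[OF V subring_adjoin[OF R]]
          p(4) \<open>U \<subseteq> V\<close> Suc.prems by auto
    qed
    then show ?case using ideal_inD(3)[OF U _ p(4)] by fastforce
  qed
  moreover have "\<exists>n. \<forall>i\<ge>n. coeff q i = 0" for q :: "'a poly"
    by (rule exI[of _ "Suc (degree q)"]) (simp add: coeff_eq_0 Suc_le_eq)
  ultimately have "V \<subseteq> U"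
    using ideal_inD(1)[OF V] unfolding adjoin_def by fast
  then show ?thesis using \<open>U \<subseteq> V\<close> by blast
qed

text \<open>Hilbert's basis argument. The ideals \<open>L j n\<close> grow in both indices. The
  diagonal \<open>L j j\<close> is stable from \<open>m\<close> on, which settles all levels n >= m
  by squeezing; the finitely many lower levels stabilize separately, and \<open>M\<close> lies past
  all these points.\<close>

lemma acc_adjoin:
  assumes R: "subring R" and acc: "acc_subring R"
  shows "acc_subring (adjoin R y)"
  unfolding acc_subring_def
proof (intro allI impI)
  fix U :: "nat \<Rightarrow> 'a set"
  assume U: "\<forall>j. ideal_in (adjoin R y) (U j) \<and> U j \<subseteq> U (Suc j)"
  define L where "L j n = leading_coeffs R y (U j) n" for j n
  have L: "ideal_in R (L j n)" for j n
    unfolding L_def using leading_coeffs_ideal[OF R] U by blast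
  have Lj: "L j n \<subseteq> L (Suc j) n" for j n
    unfolding L_def using leading_coeffs_mono U by blast
  have Ln: "L j n \<subseteq> L j (Suc n)" for j n
    unfolding L_def using leading_coeffs_Suc[OF R] U by blast
  have mono: "L j n \<subseteq> L j' n'" if "j \<le> j'" "n \<le> n'" for j j' n n'
    using lift_Suc_mono_le[of "\<lambda>j. L j n" j j'] lift_Suc_mono_le[of "L j'" n n'] Lj Ln that by blast
  have "\<exists>m. \<forall>j\<ge>m. L j n = L m n" for n
    using acc[unfolded acc_subring_def, rule_format, of "\<lambda>j. L j n"] L Lj by simp
  then obtain r where r: "\<And>n j. j \<ge> r n \<Longrightarrow> L j n = L (r n) n" by metis
  have "\<exists>m. \<forall>j\<ge>m. L j j = L m m"
    using acc[unfolded acc_subring_def, rule_format, of "\<lambda>j. L j j"] L mono[of j "Suc j" j "Suc j" for j] by auto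
  then obtain m where m: "\<And>j. j \<ge> m \<Longrightarrow> L j j = L m m" by metis
  define M where "M = Max (insert m (r ` {..<m}))"
  have "M \<ge> m" "n < m \<Longrightarrow> M \<ge> r n" for n unfolding M_def by auto
  have stable: "L j n = L M n" if "j \<ge> M" for j n
  proof (cases "n < m")
    case True
    then show ?thesis using r[of n j] r[of n M] \<open>n < m \<Longrightarrow> M \<ge> r n\<close> that by simp
  next
    case False
    have "L m m \<subseteq> L j' n" "L j' n \<subseteq> L m m" if "j' \<ge> m" for j'
      using mono[of m j' m n] mono[of j' "max j' n" n "max j' n"] m[of "max j' n"] that False by auto
    then show ?thesis using that \<open>M \<ge> m\<close> by (metis le_trans subset_antisym)
  qed
  have "U j = U M" if "j \<ge> M" for j
  proof -
    have "U M \<subseteq> U j" using lift_Suc_mono_le[of U M j] U that by blast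
    then have "U M = U j"
      using leading_coeffs_determine[OF R, of y "U M" "U j"] U stable[OF that] by (simp add: L_def)
    then show ?thesis ..
  qed
  then show "\<exists>m. \<forall>j\<ge>m. U j = U m" by blast
qed

lemma acc_constants:
  assumes "noetherian TYPE('a::comm_ring_1)"
  shows "acc_subring (range (\<lambda>c::'a. [:c:]))"
  unfolding acc_subring_def
proof (intro allI impI)
  fix U :: "nat \<Rightarrow> 'a poly set"
  assume U: "\<forall>j. ideal_in (range (\<lambda>c. [:c:])) (U j) \<and> U j \<subseteq> U (Suc j)"
  have mono: "U i \<subseteq> U j" if "i \<le> j" for i j using lift_Suc_mono_le[of U] U that by blast
  define A where "A = {c. \<exists>j. [:c:] \<in> U j}"
  have idj: "is_ideal {c. [:c:] \<in> U j}" for j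
  proof (rule idealI)
    show "x + y \<in> {c. [:c:] \<in> U j}" if "x \<in> {c. [:c:] \<in> U j}" "y \<in> {c. [:c:] \<in> U j}" for x y
      using ideal_inD(3)[of _ "U j" "[:x:]" "[:y:]"] U that by auto
    show "d * x \<in> {c. [:c:] \<in> U j}" if "x \<in> {c. [:c:] \<in> U j}" for d x
      using ideal_inD(4)[of "range (\<lambda>c. [:c:])" "U j" "[:d:]" "[:x:]"] U that
      by (simp add: mult.commute)
    show "0 \<in> {c. [:c:] \<in> U j}" using ideal_inD(2)[of _ "U j"] U by auto
  qed
  have "is_ideal A"
  proof (rule idealI)
    show "x + y \<in> A" if xy: "x \<in> A" "y \<in> A" for x y
    proof -
      obtain i j where "[:x:] \<in> U i" "[:y:] \<in> U j" using xy unfolding A_def by blast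
      then have "[:x:] \<in> U (max i j)" "[:y:] \<in> U (max i j)"
        using mono[of i "max i j"] mono[of j "max i j"] by auto
      then show ?thesis using ideal_add[OF idj[of "max i j"]] unfolding A_def by blast
    qed
    show "d * x \<in> A" if "x \<in> A" for d x
      using that ideal_mult_left[OF idj] unfolding A_def by blast
  qed (use ideal_0[OF idj] in \<open>auto simp: A_def\<close>)
  then obtain F where F: "finite F" "A = ideal_gen F"
    using assms unfolding noetherian_def by blast
  then have "\<forall>c\<in>F. \<exists>j. [:c:] \<in> U j" using ideal_gen_base unfolding A_def by blast
  then obtain r where r: "\<And>c. c \<in> F \<Longrightarrow> [:c:] \<in> U (r c)" by metis
  define m where "m = Max (insert 0 (r ` F))"
  have "F \<subseteq> {c. [:c:] \<in> U m}"
  proof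
    fix c assume "c \<in> F"
    then have "r c \<le> m" using \<open>finite F\<close> by (simp add: m_def)
    then show "c \<in> {c. [:c:] \<in> U m}" using r[OF \<open>c \<in> F\<close>] mono[of "r c" m] by blast
  qed
  then have "A \<subseteq> {c. [:c:] \<in> U m}" unfolding F by (rule ideal_gen_minimal[OF _ idj])
  then have "U j \<subseteq> U m" for j
    using ideal_inD(1)[of "range (\<lambda>c. [:c:])" "U j"] U unfolding A_def by blast
  then show "\<exists>m. \<forall>j\<ge>m. U j = U m" using mono by blast
qed

section \<open>Finitely generated subalgebras and the Rees algebra of an ideal\<close>

lemma subring_subalgebra_gen: "subring (subalgebra_gen X)"
  unfolding subring_def
proof (intro conjI ballI)
  fix p q assume pq: "p \<in> subalgebra_gen X" "q \<in> subalgebra_gen X"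
  then show "p * q \<in> subalgebra_gen X" by (rule subalgebra_gen.mult)
  have "[:-1:] * q \<in> subalgebra_gen X" using pq by (intro subalgebra_gen.mult subalgebra_gen.const)
  then show "p - q \<in> subalgebra_gen X" using subalgebra_gen.add[OF pq(1)] by fastforce
qed (use subalgebra_gen.const[of 1] in \<open>simp add: one_pCons\<close>)

lemma subalgebra_gen_minimal:
  assumes "subring R" "\<And>c. [:c:] \<in> R" "X \<subseteq> R"
  shows "subalgebra_gen X \<subseteq> R"
proof
  fix p assume "p \<in> subalgebra_gen X"
  then show "p \<in> R" by induction (use assms in \<open>auto simp: subringD\<close>)
qed

lemma subalgebra_gen_empty: "subalgebra_gen {} = range (\<lambda>c. [:c:])"
proof
  have "subring (range (\<lambda>c::'a. [:c:]))"
    unfolding subring_def by (auto simp: image_iff one_pCons intro: exI[of _ "_ * _"] exI[of _ "_ - _"])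
  then show "subalgebra_gen {} \<subseteq> range (\<lambda>c::'a. [:c:])" by (rule subalgebra_gen_minimal) auto
qed (auto intro: subalgebra_gen.const)

lemma subalgebra_gen_insert: "subalgebra_gen (insert y X) = adjoin (subalgebra_gen X) y"
proof
  have R: "subring (subalgebra_gen X)" by (rule subring_subalgebra_gen)
  show "subalgebra_gen (insert y X) \<subseteq> adjoin (subalgebra_gen X) y"
    using adjoin_superset[OF R, of y] adjoin_generator[OF R] subalgebra_gen.const subalgebra_gen.base
    by (intro subalgebra_gen_minimal subring_adjoin[OF R]) blast+
  have S: "subring (subalgebra_gen (insert y X))" by (rule subring_subalgebra_gen)
  have XS: "subalgebra_gen X \<subseteq> subalgebra_gen (insert y X)"
    by (intro subalgebra_gen_minimal[OF S]) (auto intro: subalgebra_gen.intros)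
  have "poly q y \<in> subalgebra_gen (insert y X)" if "\<forall>i. coeff q i \<in> subalgebra_gen X" for q
    using that
  proof (induction q)
    case 0
    then show ?case using S by (simp add: subringD)
  next
    case (pCons a q)
    have "coeff q i \<in> subalgebra_gen X" for i
      using pCons.prems[rule_format, of "Suc i"] by simp
    moreover have "a \<in> subalgebra_gen X" using pCons.prems[rule_format, of 0] by simp
    ultimately show ?case using pCons.IH XS subringD[OF S]
      by (auto intro: subalgebra_gen.intros)
  qed
  then show "adjoin (subalgebra_gen X) y \<subseteq> subalgebra_gen (insert y X)"
    unfolding adjoin_def by blast
qed

lemma acc_subalgebra_gen:
  assumes "noetherian TYPE('a::comm_ring_1)" "finite (X :: 'a poly set)"
  shows "acc_subring (subalgebra_gen X)"
  using assms(2)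
proof induction
  case empty
  then show ?case using acc_constants[OF assms(1)] by (simp add: subalgebra_gen_empty)
next
  case (insert y X)
  then show ?case by (simp add: subalgebra_gen_insert acc_adjoin subring_subalgebra_gen)
qed

lemma rees_algebra_ideal_pow_subset:
  assumes "A = ideal_gen F"
  shows "rees_algebra (ideal_pow A) \<subseteq> subalgebra_gen ((\<lambda>c. Polynomial.monom c 1) ` F)"
    (is "_ \<subseteq> ?S")
proof
  have S: "subring ?S" by (rule subring_subalgebra_gen)
  have ideal: "is_ideal {c. Polynomial.monom c n \<in> ?S}" for n
  proof (rule idealI)
    show "d * c \<in> {c. Polynomial.monom c n \<in> ?S}" if "c \<in> {c. Polynomial.monom c n \<in> ?S}" for c d
      using subringD(4)[OF S subalgebra_gen.const[of d]] that by (fastforce simp: smult_monom)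
  qed (use subringD[OF S] in \<open>auto simp: add_monom[symmetric]\<close>)
  have gen: "A \<subseteq> {c. Polynomial.monom c 1 \<in> ?S}"
    unfolding assms by (intro ideal_gen_minimal ideal) (auto intro: subalgebra_gen.base)
  have pow: "ideal_pow A n \<subseteq> {c. Polynomial.monom c n \<in> ?S}" for n
  proof (induction n)
    case 0
    then show ?case by (auto simp: monom_0 intro: subalgebra_gen.const)
  next
    case (Suc n)
    have "x * y \<in> {c. Polynomial.monom c (Suc n) \<in> ?S}" if "x \<in> A" "y \<in> ideal_pow A n" for x y
      using subringD(4)[OF S, of "Polynomial.monom x 1" "Polynomial.monom y n"] that gen Suc
      by (auto simp: mult_monom)
    then show ?case unfolding ideal_pow.simps by (intro ideal_mult_minimal ideal) 
  qed
  fix p assume "p \<in> rees_algebra (ideal_pow A)"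
  then have "(\<Sum>i\<le>degree p. Polynomial.monom (coeff p i) i) \<in> ?S"
    using pow unfolding rees_algebra_def by (intro subring_sum[OF S]) blast
  then show "p \<in> ?S" by (simp add: poly_as_sum_of_monoms)
qed

lemma subring_rees_algebra: "subring (rees_algebra (ideal_pow A))"
  unfolding subring_def rees_algebra_def
proof (intro conjI ballI CollectI allI)
  show "coeff 1 n \<in> ideal_pow A n" for n
    using ideal_0[OF ideal_ideal_pow, of A n] by (cases n) (simp_all add: coeff_1)
  fix p q n assume pq: "p \<in> {p. \<forall>n. coeff p n \<in> ideal_pow A n}" "q \<in> {p. \<forall>n. coeff p n \<in> ideal_pow A n}"
  then show "coeff (p - q) n \<in> ideal_pow A n"
    by (auto intro: ideal_diff ideal_ideal_pow)
  have "coeff p i * coeff q (n - i) \<in> ideal_pow A n" if "i \<le> n" for i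
    using ideal_pow_add_mem[of "coeff p i" A i "coeff q (n - i)" "n - i"] pq that by simp
  then show "coeff (p * q) n \<in> ideal_pow A n"
    unfolding coeff_mult by (intro ideal_sum ideal_ideal_pow) simp
qed

lemma acc_rees_algebra:
  fixes A :: "'a::comm_ring_1 set"
  assumes "noetherian TYPE('a)" "is_ideal A"
  shows "acc_subring (rees_algebra (ideal_pow A))"
proof -
  obtain F where F: "finite F" "A = ideal_gen F" using assms unfolding noetherian_def by blast
  let ?X = "(\<lambda>c. Polynomial.monom c 1) ` F"
  have "?X \<subseteq> rees_algebra (ideal_pow A)"
  proof (safe, unfold rees_algebra_def, safe)
    fix c n assume "c \<in> F"
    then have "c \<in> ideal_pow A 1" using ideal_pow_1[OF assms(2)] F ideal_gen_base by blast
    then show "coeff (Polynomial.monom c 1) n \<in> ideal_pow A n"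
      using ideal_0[OF ideal_ideal_pow] by (auto simp del: ideal_pow.simps)
  qed
  moreover have "[:c:] \<in> rees_algebra (ideal_pow A)" for c
    unfolding rees_algebra_def using ideal_0[OF ideal_ideal_mult]
    by (auto simp: coeff_pCons split: nat.splits)
  ultimately have "subalgebra_gen ?X = rees_algebra (ideal_pow A)"
    using subalgebra_gen_minimal[OF subring_rees_algebra] rees_algebra_ideal_pow_subset[OF F(2)]
    by (metis subset_antisym)
  then show ?thesis using acc_subalgebra_gen[OF assms(1), of ?X] F by simp
qed

text \<open>Homogeneous ideals of the Rees algebra, given by their graded pieces.\<close>

lemma acc_graded:
  fixes A :: "'a::comm_ring_1 set" and U :: "nat \<Rightarrow> nat \<Rightarrow> 'a set"
  assumes "noetherian TYPE('a)" "is_ideal A"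
    and ideal: "\<And>j m. is_ideal (U j m)" and sub: "\<And>j m. U j m \<subseteq> ideal_pow A m"
    and mult: "\<And>j m n x y. x \<in> ideal_pow A m \<Longrightarrow> y \<in> U j n \<Longrightarrow> x * y \<in> U j (m + n)"
    and mono: "\<And>j m. U j m \<subseteq> U (Suc j) m"
  shows "\<exists>j0. \<forall>j\<ge>j0. U j = U j0"
proof -
  have "ideal_in (rees_algebra (ideal_pow A)) (rees_algebra (U j))" for j
    unfolding ideal_in_def
  proof (intro conjI ballI)
    show "rees_algebra (U j) \<subseteq> rees_algebra (ideal_pow A)" using sub by (auto simp: rees_algebra_def)
    show "0 \<in> rees_algebra (U j)" using ideal_0[OF ideal] by (simp add: rees_algebra_def)
    show "x + y \<in> rees_algebra (U j)" if "x \<in> rees_algebra (U j)" "y \<in> rees_algebra (U j)" for x y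
      using that ideal_add[OF ideal] by (simp add: rees_algebra_def)
    fix p q assume pq: "p \<in> rees_algebra (ideal_pow A)" "q \<in> rees_algebra (U j)"
    have "coeff p i * coeff q (n - i) \<in> U j n" if "i \<le> n" for i n
      using mult[of "coeff p i" i "coeff q (n - i)" j "n - i"] pq that by (simp add: rees_algebra_def)
    then show "p * q \<in> rees_algebra (U j)"
      by (auto simp: rees_algebra_def coeff_mult intro!: ideal_sum ideal)
  qed
  moreover have "rees_algebra (U j) \<subseteq> rees_algebra (U (Suc j))" for j
    using mono by (auto simp: rees_algebra_def)
  ultimately obtain j0 where j0: "\<And>j. j \<ge> j0 \<Longrightarrow> rees_algebra (U j) = rees_algebra (U j0)"
    using acc_rees_algebra[OF assms(1,2), unfolded acc_subring_def, rule_format, of "\<lambda>j. rees_algebra (U j)"]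
    by auto
  \<comment> \<open>Monomials recover the graded pieces, so one index works in all degrees at
    once.\<close>
  have recover: "U j = (\<lambda>m. {c. Polynomial.monom c m \<in> rees_algebra (U j)})" for j
    using ideal_0[OF ideal] by (auto simp: rees_algebra_def fun_eq_iff)
  show ?thesis using j0 recover by metis
qed

subsection \<open>Valuations attached to an almost integrally closed filtration\<close>

text \<open>Axioms for the closures of the powers of an ideal. \<open>J_almost_closed\<close>
  expresses, for homogeneous elements, that the extended Rees algebra is integrally closed;
  \<open>J_acc\<close> is the chain condition for homogeneous ideals of its part in degrees >=
  0.\<close>

locale closed_filtration =
  fixes J :: "nat \<Rightarrow> 'a::idom set"
  assumes J_0: "J 0 = UNIV"
    and J_ideal: "is_ideal (J n)"
    and J_Suc: "J (Suc n) \<subseteq> J n"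
    and J_mult: "x \<in> J m \<Longrightarrow> y \<in> J n \<Longrightarrow> x * y \<in> J (m + n)"
    and J_nonzero: "\<exists>x\<in>J n. x \<noteq> 0"
    and J_almost_closed: "z \<noteq> 0 \<Longrightarrow> (\<And>l. z * x ^ l \<in> J (n * l)) \<Longrightarrow> x \<in> J n"
    and J_acc: "(\<And>j m. is_ideal (U j m)) \<Longrightarrow> (\<And>j m. U j m \<subseteq> J m) \<Longrightarrow>
      (\<And>j m n x y. x \<in> J m \<Longrightarrow> y \<in> U j n \<Longrightarrow> x * y \<in> U j (m + n)) \<Longrightarrow>
      (\<And>j m. U j m \<subseteq> U (Suc j) m) \<Longrightarrow> \<exists>j0. \<forall>j\<ge>j0. U j = U j0"
begin

text \<open>The extended Rees algebra \<open>B = (\<Oplus>m. F m t\<^sup>m)\<close> has the homogeneous element \<open>u = t\<^sup>-\<^sup>1\<close> of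
  degree \<open>-1\<close>. An element of degree \<open>m\<close> is represented by its coefficient in \<open>F m\<close> together
  with \<open>m\<close>.\<close>

definition F :: "int \<Rightarrow> 'a set"
  where "F m = J (nat m)"

lemma F_ideal: "is_ideal (F m)"
  by (simp add: F_def J_ideal)

lemma F_nonpos: "m \<le> 0 \<Longrightarrow> F m = UNIV"
  by (simp add: F_def J_0)

lemma F_antimono: "m \<le> n \<Longrightarrow> F n \<subseteq> F m"
  using lift_Suc_antimono_le[of J "nat m" "nat n"] J_Suc by (simp add: F_def nat_mono)

lemma F_mult:
  assumes "x \<in> F p" "y \<in> F q"
  shows "x * y \<in> F (p + q)"
proof (cases "p \<le> 0 \<or> q \<le> 0")
  case True
  then have "x \<in> F (p + q) \<or> y \<in> F (p + q)"
    using F_antimono[of "p + q" p] F_antimono[of "p + q" q] assms by auto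
  then show ?thesis using ideal_mult_left[OF F_ideal] ideal_mult_right[OF F_ideal] by blast
next
  case False
  then show ?thesis using J_mult[of x "nat p" y "nat q"] assms by (simp add: F_def nat_add_distrib)
qed

lemma F_mult': "x \<in> F p \<Longrightarrow> y \<in> F q \<Longrightarrow> r \<le> p + q \<Longrightarrow> x * y \<in> F r"
  using F_mult F_antimono by blast

lemma F_power: "x \<in> F p \<Longrightarrow> x ^ k \<in> F (int k * p)"
proof (induction k)
  case (Suc k)
  then show ?case using F_mult[of x p "x ^ k" "int k * p"] by (simp add: algebra_simps)
qed (simp add: F_nonpos)

text \<open>A constant error \<open>j\<close> in the degree is removed by multiplying
  \<open>z\<close> with a nonzero element of \<open>F (- j)\<close>.\<close>

lemma F_almost_closed:
  assumes "z \<noteq> 0" "\<And>l. z * x ^ l \<in> F (int l * m + j)"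
  shows "x \<in> F m"
proof (cases "m \<le> 0")
  case False
  obtain d where d: "d \<in> F (- j)" "d \<noteq> 0" using J_nonzero[of "nat (- j)"] by (auto simp: F_def)
  have "(d * z) * x ^ l \<in> J (nat m * l)" for l
    using F_mult[OF d(1) assms(2)[of l]] False
    by (simp add: F_def mult.assoc nat_mult_distrib mult.commute[of "nat m"])
  then show ?thesis using J_almost_closed[of "d * z" x "nat m"] assms(1) d by (simp add: F_def)
qed (simp add: F_nonpos)

definition graded_ideal :: "(nat \<Rightarrow> 'a set) \<Rightarrow> bool"
  where "graded_ideal U \<longleftrightarrow> (\<forall>m. is_ideal (U m) \<and> U m \<subseteq> J m) \<and>
    (\<forall>m n. \<forall>x\<in>J m. \<forall>y\<in>U n. x * y \<in> U (m + n))"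

lemma graded_ideal_maximal:
  assumes "U0 \<in> \<U>" "\<And>U. U \<in> \<U> \<Longrightarrow> graded_ideal U"
  shows "\<exists>M\<in>\<U>. \<forall>U\<in>\<U>. (\<forall>m. M m \<subseteq> U m) \<longrightarrow> U = M"
proof (rule ccontr)
  assume "\<not> ?thesis"
  then have step: "\<exists>V. V \<in> \<U> \<and> (\<forall>m. U m \<subseteq> V m) \<and> V \<noteq> U" if "U \<in> \<U>" for U
    using that by meson
  have "\<exists>f. \<forall>i::nat. f i \<in> \<U> \<and> ((\<forall>m. f i m \<subseteq> f (Suc i) m) \<and> f (Suc i) \<noteq> f i)"
    by (rule dependent_nat_choice) (use step assms(1) in \<open>simp_all, blast\<close>)
  then obtain f where f: "\<And>i::nat. f i \<in> \<U>" "\<And>i. (\<forall>m. f i m \<subseteq> f (Suc i) m) \<and> f (Suc i) \<noteq> f i"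
    by meson
  have graded: "graded_ideal (f j)" for j using f(1) assms(2) by blast
  have "\<exists>j0. \<forall>j\<ge>j0. f j = f j0"
    by (rule J_acc) (use graded f(2) in \<open>simp_all add: graded_ideal_def\<close>)
  then obtain j0 where "f j0 = f j0" "f (Suc j0) = f j0" by (meson le_SucI order_refl)
  then show False using f(2) by blast
qed

text \<open>In degree d the ideal uB is \<open>F (d + 1)\<close>, so this is a graded piece of the
  annihilator of the class of x t^n in B / uB. Negative degrees are left out because elements of
  negative degree lie in uB.\<close>

definition annihilator :: "'a \<Rightarrow> int \<Rightarrow> nat \<Rightarrow> 'a set"
  where "annihilator x n m = {y \<in> J m. x * y \<in> F (n + int m + 1)}"

lemma graded_ideal_annihilator: "graded_ideal (annihilator x n)"
  unfolding graded_ideal_def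
proof (intro conjI allI ballI)
  fix m k
  show "is_ideal (annihilator x n m)"
    unfolding annihilator_def
    by (intro idealI) (auto simp: ideal_0 ideal_add distrib_left mult.left_commute ideal_mult_left F_ideal J_ideal)
  show "annihilator x n m \<subseteq> J m" by (auto simp: annihilator_def)
  fix w y assume wy: "w \<in> J m" "y \<in> annihilator x n k"
  then have "w \<in> F (int m)" "x * y \<in> F (n + int k + 1)" by (auto simp: F_def annihilator_def)
  from F_mult'[OF this, of "n + int (m + k) + 1"] wy
  show "w * y \<in> annihilator x n (m + k)"
    by (simp add: annihilator_def mult.left_commute J_mult)
qed

lemma annihilator_int: "y \<in> F m \<Longrightarrow> m \<ge> 0 \<Longrightarrow> y \<in> annihilator x n (nat m) \<longleftrightarrow> x * y \<in> F (n + m + 1)"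
  by (simp add: annihilator_def F_def)

text \<open>The annihilator of the class of \<open>x t\<^sup>n\<close> in \<open>B / u B\<close> is a prime ideal of \<open>B\<close>.\<close>

definition prime_pair :: "'a \<Rightarrow> int \<Rightarrow> bool"
  where "prime_pair x n \<longleftrightarrow> x \<in> F n \<and> x \<notin> F (n + 1) \<and>
    (\<forall>p q. \<forall>y\<in>F p. \<forall>z\<in>F q. x * y \<notin> F (n + p + 1) \<longrightarrow> x * z \<notin> F (n + q + 1) \<longrightarrow>
      x * (y * z) \<notin> F (n + (p + q) + 1))"

text \<open>An annihilator that is maximal among those of the nonzero multiples of a class is prime:
  if y does not kill gh, then the annihilator of ghy contains that of gh, so the two agree, and what
  does not kill gh does not kill ghy.\<close>

lemma prime_multiple:
  assumes "g \<in> F p" "g \<notin> F (p + 1)"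
  obtains h q where "h \<in> F q" "prime_pair (g * h) (p + q)"
proof -
  define \<U> where "\<U> = {annihilator (g * h) (p + q) | h q. h \<in> F q \<and> g * h \<notin> F (p + q + 1)}"
  have "annihilator (g * 1) (p + 0) \<in> \<U>"
    unfolding \<U>_def using assms by (intro CollectI exI[of _ 1] exI[of _ 0]) (simp add: F_nonpos)
  moreover have "graded_ideal U" if "U \<in> \<U>" for U
    using that graded_ideal_annihilator by (auto simp: \<U>_def)
  ultimately have "\<exists>M\<in>\<U>. \<forall>U\<in>\<U>. (\<forall>m. M m \<subseteq> U m) \<longrightarrow> U = M"
    by (rule graded_ideal_maximal)
  then obtain M where "M \<in> \<U>" and M: "\<And>U. U \<in> \<U> \<Longrightarrow> (\<And>m. M m \<subseteq> U m) \<Longrightarrow> U = M"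
    by metis
  then obtain h q where hq: "M = annihilator (g * h) (p + q)" "h \<in> F q" "g * h \<notin> F (p + q + 1)"
    unfolding \<U>_def by blast
  have "prime_pair (g * h) (p + q)"
    unfolding prime_pair_def
  proof (intro conjI allI ballI impI)
    show "g * h \<in> F (p + q)" by (rule F_mult[OF assms(1) hq(2)])
    show "g * h \<notin> F (p + q + 1)" by fact
    fix i j y z
    assume yz: "y \<in> F i" "z \<in> F j" and y: "g * h * y \<notin> F (p + q + i + 1)"
      and z: "g * h * z \<notin> F (p + q + j + 1)"
    have "annihilator (g * (h * y)) (p + (q + i)) = M"
    proof (rule M)
      show "annihilator (g * (h * y)) (p + (q + i)) \<in> \<U>"
        unfolding \<U>_def using F_mult[OF hq(2) yz(1)] y
        by (intro CollectI exI[of _ "h * y"] exI[of _ "q + i"]) (simp add: mult.assoc add.assoc)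
      show "M m \<subseteq> annihilator (g * (h * y)) (p + (q + i)) m" for m
        unfolding hq(1) annihilator_def using F_mult'[OF yz(1)]
        by (fastforce simp: mult.left_commute mult.assoc mult.commute)
    qed
    \<comment> \<open>Annihilators are compared in degrees >= 0 only; an element of negative degree
      lies in uB and kills every class.\<close>
    moreover have "j \<ge> 0"
    proof (rule ccontr)
      assume "\<not> j \<ge> 0"
      then have "g * h * z \<in> F (p + q + j + 1)"
        using F_mult'[of "g * h" "p + q" z 0] F_mult[OF assms(1) hq(2)] by (simp add: F_nonpos)
      then show False using z by blast
    qed
    ultimately have "g * (h * y) * z \<notin> F (p + (q + i) + j + 1)"
      using annihilator_int[OF yz(2)] z hq(1) by metis
    then show "g * h * (y * z) \<notin> F (p + q + (i + j) + 1)"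
      by (simp add: mult.assoc add.assoc)
  qed
  then show ?thesis using that hq(2) by blast
qed

end

section \<open>The order function of a single associated prime\<close>

locale prime_of_filtration = closed_filtration +
  fixes x :: 'a and n :: int
  assumes prime_pair: "prime_pair x n"
begin

lemma x_F: "x \<in> F n" and x_not_F: "x \<notin> F (n + 1)"
  and primeD: "y \<in> F p \<Longrightarrow> z \<in> F q \<Longrightarrow> x * y \<notin> F (n + p + 1) \<Longrightarrow> x * z \<notin> F (n + q + 1) \<Longrightarrow>
      x * (y * z) \<notin> F (n + (p + q) + 1)"
  using prime_pair unfolding prime_pair_def by blast+

lemma prime_power:
  assumes "a \<in> F p" "x * a \<notin> F (n + p + 1)" "y \<in> F q" "x * y \<notin> F (n + q + 1)"
  shows "a * y ^ k \<in> F (p + int k * q) \<and> x * (a * y ^ k) \<notin> F (n + (p + int k * q) + 1)"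
proof (induction k)
  case (Suc k)
  then show ?case
    using F_mult[of "a * y ^ k" "p + int k * q" y q] primeD[of "a * y ^ k" "p + int k * q" y q] assms
    by (simp add: algebra_simps)
qed (use assms in simp)

text \<open>The prime \<open>P\<close> is invertible after localization: \<open>(x t\<^sup>n / u) P\<close> is not contained in \<open>P\<close>,
  so \<open>y\<close> is a uniformizer of \<open>B\<^sub>P\<close>.\<close>

lemma uniformizer:
  shows "\<exists>y m. y \<in> F m \<and> x * y \<in> F (n + m + 1) \<and> x * (x * y) \<notin> F (n + (n + m + 1) + 1)"
proof (rule ccontr)
  assume "\<not> ?thesis"
  then have *: "x * (x * y) \<in> F (n + (n + m + 1) + 1)" if "y \<in> F m" "x * y \<in> F (n + m + 1)" for y m
    using that by blast
  \<comment> \<open>Now x t^n / u maps P to P. Starting from u in P, that is from 1 in degree -1,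
    all u (x t^n / u)^l stay in B, so x t^n / u is almost integral and lies in B, which means that x
    is in \<open>F (n + 1)\<close>.\<close>
  have "1 * x ^ l \<in> F (int l * (n + 1) + (-1)) \<and> x * (1 * x ^ l) \<in> F (n + (int l * (n + 1) + (-1)) + 1)" for l
  proof (induction l)
    case 0
    then show ?case using x_F by (simp add: F_nonpos)
  next
    case (Suc l)
    then show ?case using *[of "1 * x ^ l" "int l * (n + 1) + (-1)"] by (simp add: algebra_simps)
  qed
  then have "x \<in> F (n + 1)" using F_almost_closed[of 1 x "n + 1" "-1"] by simp
  then show False using x_not_F by blast
qed

text \<open>The \<open>P\<close>-adic order: since \<open>x t\<^sup>n / u\<close> has order \<open>-1\<close>, the order of \<open>f t\<^sup>m\<close> is the number of
  times that it can be multiplied by \<open>x t\<^sup>n / u\<close> without leaving \<open>B\<close>.\<close>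

definition ord :: "'a \<Rightarrow> int \<Rightarrow> nat"
  where "ord f m = (LEAST l. f * x ^ Suc l \<notin> F (int (Suc l) * (n + 1) + m))"

text \<open>The least \<open>l\<close> exists: if f t^m could be multiplied by x t^n / u forever, f
  would be a common denominator of all its powers, and almost closedness would put x into
  \<open>F (n + 1)\<close>.\<close>

lemma ord_props:
  assumes "f \<noteq> 0" "f \<in> F m"
  shows "j \<le> ord f m \<Longrightarrow> f * x ^ j \<in> F (int j * (n + 1) + m)"
    and "f * x ^ Suc (ord f m) \<notin> F (int (Suc (ord f m)) * (n + 1) + m)"
proof -
  have "\<exists>l. f * x ^ Suc l \<notin> F (int (Suc l) * (n + 1) + m)"
  proof (rule ccontr)
    assume *: "\<nexists>l. f * x ^ Suc l \<notin> F (int (Suc l) * (n + 1) + m)"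
    have "f * x ^ l \<in> F (int l * (n + 1) + m)" for l
    proof (cases l)
      case (Suc l')
      then show ?thesis using * by blast
    qed (use assms in simp)
    then show False using F_almost_closed[of f x "n + 1" m] assms x_not_F by blast
  qed
  then show "f * x ^ Suc (ord f m) \<notin> F (int (Suc (ord f m)) * (n + 1) + m)"
    unfolding ord_def by (rule LeastI_ex)
  show "f * x ^ j \<in> F (int j * (n + 1) + m)" if "j \<le> ord f m"
  proof (cases j)
    case (Suc l)
    then show ?thesis using not_less_Least[of l "\<lambda>l. f * x ^ Suc l \<notin> F (int (Suc l) * (n + 1) + m)"] that
      unfolding ord_def by auto
  qed (use assms in simp)
qed

text \<open>With \<open>y\<close> from \<open>uniformizer\<close>, \<open>a\<close> and
  \<open>x * y\<close> represent elements outside P, hence so does \<open>a * (x * y) ^ k\<close>.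
  If \<open>f * x ^ (l + k)\<close> were in B at its degree, the remaining factors y, which lie in
  P, would put this product into P.\<close>

lemma beyond_ord:
  assumes "f * x ^ l \<in> F (int l * (n + 1) + m)" "f * x ^ Suc l \<notin> F (int (Suc l) * (n + 1) + m)"
    and "k > 0"
  shows "f * x ^ (l + k) \<notin> F (int (l + k) * (n + 1) + m)"
proof
  assume in_F: "f * x ^ (l + k) \<in> F (int (l + k) * (n + 1) + m)"
  obtain y d where y: "y \<in> F d" "x * y \<in> F (n + d + 1)" "x * (x * y) \<notin> F (n + (n + d + 1) + 1)"
    using uniformizer by blast
  define a p s where "a = f * x ^ l" and "p = int l * (n + 1) + m" and "s = n + d + 1"
  have "a \<in> F p" "x * a \<notin> F (n + p + 1)"
    using assms by (simp_all add: a_def p_def algebra_simps)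
  then have "x * (a * (x * y) ^ k) \<notin> F (n + (p + int k * s) + 1)"
    using prime_power[of a p "x * y" s k] y by (simp add: s_def)
  moreover have "x * (a * (x * y) ^ k) \<in> F (n + (p + int k * s) + 1)"
  proof -
    obtain k' where k: "k = Suc k'" using \<open>k > 0\<close> by (cases k) auto
    have "f * x ^ (l + k) * y ^ k' * (x * y) \<in> F (int (l + k) * (n + 1) + m + int k' * d + s)"
      unfolding s_def by (rule F_mult[OF F_mult[OF in_F F_power[OF y(1)]] y(2)])
    moreover have "x * (a * (x * y) ^ k) = f * x ^ (l + k) * y ^ k' * (x * y)"
      by (simp add: a_def k power_add power_mult_distrib mult_ac)
    moreover have "int (l + k) * (n + 1) + m + int k' * d + s = n + (p + int k * s) + 1"
      by (simp add: p_def s_def k algebra_simps)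
    ultimately show ?thesis by metis
  qed
  ultimately show False by blast
qed

lemma ord_unique:
  assumes "f * x ^ l \<in> F (int l * (n + 1) + m)" "f * x ^ Suc l \<notin> F (int (Suc l) * (n + 1) + m)"
    and "f \<in> F m"
  shows "ord f m = l"
proof (rule linorder_cases[of "ord f m" l])
  have "f \<noteq> 0" using assms(2) ideal_0[OF F_ideal] by auto
  note props = ord_props[OF this assms(3)]
  {
    assume "ord f m < l"
    then show ?thesis using beyond_ord[OF props(1)[OF order_refl] props(2), of "l - ord f m"] assms(1) by simp
  next
    assume "ord f m > l"
    then show ?thesis using beyond_ord[OF assms(1,2), of "ord f m - l"] props(1)[OF order_refl] by simp
  }
qed

text \<open>Multiplied by x t^n / u as often as its order says, f becomes an element of B outside P.
  As P is prime, the product of two such elements is again outside P, so orders add.\<close>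

lemma ord_mult:
  assumes "f \<noteq> 0" "f \<in> F m" "g \<noteq> 0" "g \<in> F p"
  shows "ord (f * g) (m + p) = ord f m + ord g p"
proof (rule ord_unique)
  define l k where "l = ord f m" and "k = ord g p"
  have f: "f * x ^ l \<in> F (int l * (n + 1) + m)" "x * (f * x ^ l) \<notin> F (n + (int l * (n + 1) + m) + 1)"
    using ord_props[OF assms(1,2)] by (simp_all add: l_def algebra_simps)
  have g: "g * x ^ k \<in> F (int k * (n + 1) + p)" "x * (g * x ^ k) \<notin> F (n + (int k * (n + 1) + p) + 1)"
    using ord_props[OF assms(3,4)] by (simp_all add: k_def algebra_simps)
  have "f * g * x ^ (l + k) = f * x ^ l * (g * x ^ k)" by (simp add: power_add mult_ac)
  moreover have "int (l + k) * (n + 1) + (m + p) = int l * (n + 1) + m + (int k * (n + 1) + p)"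
    by (simp add: algebra_simps)
  ultimately show "f * g * x ^ (ord f m + ord g p) \<in> F (int (ord f m + ord g p) * (n + 1) + (m + p))"
    using F_mult[OF f(1) g(1)] unfolding l_def k_def by metis
  have "f * g * x ^ Suc (l + k) = x * (f * x ^ l * (g * x ^ k))" by (simp add: power_add mult_ac)
  moreover have "int (Suc (l + k)) * (n + 1) + (m + p) = n + (int l * (n + 1) + m + (int k * (n + 1) + p)) + 1"
    by (simp add: algebra_simps)
  ultimately show "f * g * x ^ Suc (ord f m + ord g p) \<notin> F (int (Suc (ord f m + ord g p)) * (n + 1) + (m + p))"
    using primeD[OF f(1) g(1) f(2) g(2)] unfolding l_def k_def by metis
  show "f * g \<in> F (m + p)" using F_mult assms by blast
qed

lemma ord_add:
  assumes "f \<noteq> 0" "f \<in> F m" "g \<noteq> 0" "g \<in> F m" "f + g \<noteq> 0"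
  shows "ord (f + g) m \<ge> min (ord f m) (ord g m)"
proof (rule ccontr)
  assume "\<not> ?thesis"
  then have "Suc (ord (f + g) m) \<le> ord f m" "Suc (ord (f + g) m) \<le> ord g m" by auto
  then have "(f + g) * x ^ Suc (ord (f + g) m) \<in> F (int (Suc (ord (f + g) m)) * (n + 1) + m)"
    unfolding distrib_right using ord_props(1) assms by (intro ideal_add F_ideal) blast+
  then show False using ord_props(2)[of "f + g" m] assms ideal_add[OF F_ideal] by blast
qed

text \<open>The order of u, whose coefficient is 1 in degree -1. Moving f from degree m to degree 0
  multiplies it by u^m and adds m e to the order; see \<open>ord_shift\<close>.\<close>

definition e :: nat where "e = ord 1 (-1)"

lemma e_pos: "e > 0"
proof (rule ccontr)
  assume "\<not> e > 0"
  then show False using ord_props(2)[of 1 "-1"] x_F by (simp add: e_def F_nonpos)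
qed

lemma ord_one: "ord 1 (- int k) = k * e"
proof (induction k)
  case 0
  show ?case using ord_mult[of 1 0 1 0] by (simp add: F_nonpos)
next
  case (Suc k)
  have "- int (Suc k) = - int k + (-1)" by simp
  then show ?case using ord_mult[of 1 "- int k" 1 "-1"] Suc by (simp only: F_nonpos e_def) (simp add: F_nonpos)
qed

lemma ord_shift:
  assumes "f \<noteq> 0" "f \<in> F m" "m \<ge> 0"
  shows "ord f 0 = ord f m + nat m * e"
  using ord_mult[of f m 1 "- int (nat m)"] ord_one[of "nat m"] assms by (simp add: F_nonpos)

text \<open>The element u (x t^n / u)^e is a unit of B_P: it lies in B but not in P. It is the
  witness in \<open>ord_representation\<close>.\<close>

lemma u_power_unit:
  shows "x ^ e \<in> F (int e * (n + 1) - 1)" "x * x ^ e \<notin> F (n + (int e * (n + 1) - 1) + 1)"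
  using ord_props[of 1 "-1"] by (simp_all add: F_nonpos algebra_simps flip: e_def)

end

section \<open>Finiteness of the set of associated primes, and recovery of the filtration from their
  orders\<close>

context closed_filtration
begin

lemma prime_of_filtrationI: "prime_pair x n \<Longrightarrow> prime_of_filtration J x n"
  by (unfold_locales) 

lemma prime_pair_nonneg: "prime_pair x n \<Longrightarrow> n \<ge> 0"
  unfolding prime_pair_def using F_nonpos[of "n + 1"] by force

text \<open>Associated primes of uB have height one, so an inclusion of P in P' is an equality. For
  w in P' outside P, take y in P' with (x' t^n' / u) y outside P', hence outside P; both y in P and
  y outside P lead to a contradiction.\<close>

lemma annihilator_incomparable:
  assumes "prime_pair x n" "prime_pair x' n'"
    and sub: "\<And>y m. y \<in> F m \<Longrightarrow> x * y \<in> F (n + m + 1) \<Longrightarrow> x' * y \<in> F (n' + m + 1)"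
    and w: "w \<in> F m" "x' * w \<in> F (n' + m + 1)"
  shows "x * w \<in> F (n + m + 1)"
proof (rule ccontr)
  assume w': "x * w \<notin> F (n + m + 1)"
  interpret P: prime_of_filtration J x n by (rule prime_of_filtrationI[OF assms(1)])
  interpret Q: prime_of_filtration J x' n' by (rule prime_of_filtrationI[OF assms(2)])
  obtain y d where y: "y \<in> F d" "x' * y \<in> F (n' + d + 1)" "x' * (x' * y) \<notin> F (n' + (n' + d + 1) + 1)"
    using Q.uniformizer by blast
  then have \<sigma>: "x * (x' * y) \<notin> F (n + (n' + d + 1) + 1)" using sub by blast
  show False
  proof (cases "x * y \<in> F (n + d + 1)")
    case True
    \<comment> \<open>\<open>w\<close> and \<open>x' * y\<close> are outside P, yet x times their
      product regroups as (x y)(x' w), which puts the product into P.\<close>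
    have "x * (w * (x' * y)) \<notin> F (n + (m + (n' + d + 1)) + 1)"
      using P.primeD[OF w(1) y(2) w' \<sigma>] .
    moreover have "(x * y) * (x' * w) \<in> F (n + d + 1 + (n' + m + 1))"
      using F_mult[OF True w(2)] .
    ultimately show False by (simp add: mult_ac add_ac)
  next
    case False
    \<comment> \<open>Here x' t^n' / u maps P into itself: an image outside P would remain outside
      after multiplication by y, against the regrouping (x z)(x' y). As in
      \<open>uniformizer\<close>, x' t^n' / u is then almost integral.\<close>
    have step: "x * (x' * z) \<in> F (n + (n' + i + 1) + 1)" if "z \<in> F i" "x * z \<in> F (n + i + 1)" for z i
    proof (rule ccontr)
      assume "\<not> ?thesis"
      then have "x * ((x' * z) * y) \<notin> F (n + ((n' + i + 1) + d) + 1)"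
        using P.primeD[of "x' * z" "n' + i + 1" y d] y(1) False sub[OF that] by blast
      moreover have "x * z * (x' * y) \<in> F (n + i + 1 + (n' + d + 1))" by (rule F_mult[OF that(2) y(2)])
      ultimately show False by (simp add: mult_ac add_ac)
    qed
    have "1 * x' ^ l \<in> F (int l * (n' + 1) + (-1)) \<and> x * (1 * x' ^ l) \<in> F (n + (int l * (n' + 1) + (-1)) + 1)" for l
    proof (induction l)
      case 0
      then show ?case using P.x_F by (simp add: F_nonpos)
    next
      case (Suc l)
      then show ?case
        using step[of "1 * x' ^ l" "int l * (n' + 1) + (-1)"] sub[of "1 * x' ^ l" "int l * (n' + 1) + (-1)"]
        by (simp add: algebra_simps)
    qed
    then have "x' \<in> F (n' + 1)" using F_almost_closed[of 1 x' "n' + 1" "-1"] by simp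
    then show False using Q.x_not_F by blast
  qed
qed

text \<open>The annihilator of the annihilator of \<open>X\<close> plays the role of the submodule of \<open>B / u B\<close>
  generated by \<open>X\<close>.\<close>

lemma finitely_many_primes:
  "\<exists>X. finite X \<and> (\<forall>(x, n)\<in>X. prime_pair x n) \<and>
    (\<forall>x n. prime_pair x n \<longrightarrow> (\<exists>(x', n')\<in>X. \<forall>m. \<forall>y\<in>F m.
      x * y \<in> F (n + m + 1) \<longleftrightarrow> x' * y \<in> F (n' + m + 1)))"
proof -
  define N where "N X m = {w \<in> J m. \<forall>p. \<forall>y\<in>F p. (\<forall>(x, n)\<in>X. x * y \<in> F (n + p + 1)) \<longrightarrow>
      w * y \<in> F (int m + p + 1)}" for X :: "('a \<times> int) set" and m
  have graded: "graded_ideal (N X)" for X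
    unfolding graded_ideal_def
  proof (intro conjI allI ballI)
    fix m k
    show "is_ideal (N X m)"
      unfolding N_def
      by (intro idealI) (auto simp: ideal_0 ideal_add distrib_right mult.assoc ideal_mult_left F_ideal J_ideal)
    show "N X m \<subseteq> J m" by (auto simp: N_def)
    fix v w assume vw: "v \<in> J m" "w \<in> N X k"
    have "v * w * y \<in> F (int (m + k) + p + 1)"
      if "y \<in> F p" "\<forall>(x, n)\<in>X. x * y \<in> F (n + p + 1)" for p y
    proof -
      have "v \<in> F (int m)" "w * y \<in> F (int k + p + 1)" using that vw by (auto simp: N_def F_def)
      from F_mult'[OF this, of "int (m + k) + p + 1"] show ?thesis by (simp add: mult.assoc)
    qed
    then show "v * w \<in> N X (m + k)" using vw by (auto simp: N_def J_mult)
  qed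
  define \<X> where "\<X> = {X. finite X \<and> (\<forall>(x, n)\<in>X. prime_pair x n)}"
  have "N {} \<in> N ` \<X>" by (simp add: \<X>_def)
  then have "\<exists>M\<in>N ` \<X>. \<forall>U\<in>N ` \<X>. (\<forall>m. M m \<subseteq> U m) \<longrightarrow> U = M"
    by (rule graded_ideal_maximal) (use graded in blast)
  then obtain M where M: "M \<in> N ` \<X>" "\<And>U. U \<in> N ` \<X> \<Longrightarrow> (\<And>m. M m \<subseteq> U m) \<Longrightarrow> U = M"
    by metis
  from M(1) obtain X where "M = N X" "X \<in> \<X>" by (rule imageE)
  then have X: "M = N X" "finite X" "\<And>x n. (x, n) \<in> X \<Longrightarrow> prime_pair x n"
    by (auto simp: \<X>_def)
  \<comment> \<open>By maximality, adding x t^n to \<open>X\<close> does not enlarge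
    \<open>N X\<close>, so x itself belongs to \<open>N X\<close>: what kills all of
    \<open>X\<close> kills x t^n.\<close>
  have killed: "x * y \<in> F (n + p + 1)"
    if xn: "prime_pair x n" and y: "y \<in> F p" "\<And>x' n'. (x', n') \<in> X \<Longrightarrow> x' * y \<in> F (n' + p + 1)" for x n y p
  proof -
    have "insert (x, n) X \<in> \<X>" using X xn by (auto simp: \<X>_def)
    then have "N (insert (x, n) X) = N X"
      using M(2)[of "N (insert (x, n) X)"] unfolding X(1) by (auto simp: N_def)
    moreover have "x \<in> N (insert (x, n) X) (nat n)"
      using xn prime_pair_nonneg[OF xn] unfolding prime_pair_def by (auto simp: N_def F_def)
    ultimately have "x \<in> N X (nat n)" by simp
    moreover have "\<forall>(x', n')\<in>X. x' * y \<in> F (n' + p + 1)" using y(2) by blast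
    ultimately have "x * y \<in> F (int (nat n) + p + 1)" using y(1) unfolding N_def by blast
    then show ?thesis using prime_pair_nonneg[OF xn] by simp
  qed
  have "\<exists>(x', n') \<in> X. \<forall>m. \<forall>y\<in>F m. x * y \<in> F (n + m + 1) \<longleftrightarrow> x' * y \<in> F (n' + m + 1)"
    if xn: "prime_pair x n" for x n
  proof -
    interpret P: prime_of_filtration J x n by (rule prime_of_filtrationI[OF xn])
    \<comment> \<open>If no prime P' coming from \<open>X\<close> were contained in P, choose in
      each P' an element outside P. Their product kills all of \<open>X\<close>, so by
      \<open>killed\<close> it lies in P, although P is prime.\<close>
    have "\<exists>(x', n') \<in> X. \<forall>m. \<forall>y\<in>F m. x' * y \<in> F (n' + m + 1) \<longrightarrow> x * y \<in> F (n + m + 1)"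
    proof (rule ccontr)
      assume "\<not> ?thesis"
      then have *: "\<exists>m. \<exists>y\<in>F m. x' * y \<in> F (n' + m + 1) \<and> x * y \<notin> F (n + m + 1)" if "(x', n') \<in> X" for x' n'
        using that by fastforce
      have "\<exists>p. \<exists>y\<in>F p. (\<forall>(x', n')\<in>Y. x' * y \<in> F (n' + p + 1)) \<and> x * y \<notin> F (n + p + 1)"
        if "finite Y" "Y \<subseteq> X" for Y
        using that
      proof induction
        case empty
        show ?case using P.x_not_F by (intro exI[of _ 0] bexI[of _ 1]) (auto simp: F_nonpos)
      next
        case (insert c Y)
        obtain p y where y: "y \<in> F p" "\<forall>(x', n')\<in>Y. x' * y \<in> F (n' + p + 1)" "x * y \<notin> F (n + p + 1)"
          using insert by blast
        obtain x' n' where c: "c = (x', n')" by (cases c)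
        obtain m z where z: "z \<in> F m" "x' * z \<in> F (n' + m + 1)" "x * z \<notin> F (n + m + 1)"
          using *[of x' n'] insert.prems c by blast
        have "x'' * (y * z) \<in> F (n'' + (p + m) + 1)" if "(x'', n'') \<in> insert c Y" for x'' n''
        proof (cases "(x'', n'') = c")
          case True
          then show ?thesis using F_mult[OF z(2) y(1)] c by (simp add: mult_ac add_ac)
        next
          case False
          then have "x'' * y \<in> F (n'' + p + 1)" using that y(2) by blast
          then show ?thesis using F_mult[OF _ z(1)] by (fastforce simp: mult_ac add_ac)
        qed
        then show ?case
          using F_mult[OF y(1) z(1)] P.primeD[OF y(1) z(1) y(3) z(3)]
          by (intro exI[of _ "p + m"] bexI[of _ "y * z"]) auto
      qed
      from this[OF X(2) order_refl] show False using killed[OF xn] by blast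
    qed
    then obtain x' n' where x': "(x', n') \<in> X"
      and sub: "\<And>m y. y \<in> F m \<Longrightarrow> x' * y \<in> F (n' + m + 1) \<Longrightarrow> x * y \<in> F (n + m + 1)"
      by blast
    have "x' * y \<in> F (n' + m + 1)" if "y \<in> F m" "x * y \<in> F (n + m + 1)" for m y
      using annihilator_incomparable[OF X(3)[OF x'] xn sub that] .
    then show ?thesis using sub x' by blast
  qed
  then show ?thesis using X(2,3) by (intro exI[of _ X]) auto
qed

text \<open>If f is not in J m, let p < m be the last index with f in J p. Some multiple f h of its
  class in degree p has a prime annihilator P. The hypothesis gives f order at least e there, so u
  (x t^n / u)^e, which is outside P, kills the class of f h.\<close>

lemma ord_representation:
  assumes X: "\<And>x n. (x, n) \<in> X \<Longrightarrow> prime_pair x n"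
    "\<And>x n. prime_pair x n \<Longrightarrow> \<exists>(x', n') \<in> X. \<forall>m. \<forall>y\<in>F m.
      x * y \<in> F (n + m + 1) \<longleftrightarrow> x' * y \<in> F (n' + m + 1)"
    and f: "f \<noteq> 0"
    and ge: "\<And>x n. (x, n) \<in> X \<Longrightarrow>
      prime_of_filtration.ord J x n f 0 \<ge> m * prime_of_filtration.e J x n"
  shows "f \<in> J m"
proof (rule ccontr)
  assume "f \<notin> J m"
  define p where "p = (GREATEST p. p < m \<and> f \<in> J p)"
  have "m > 0" using \<open>f \<notin> J m\<close> J_0 by (cases m) auto
  then have p: "p < m" "f \<in> J p" and p_max: "\<And>q. q < m \<Longrightarrow> f \<in> J q \<Longrightarrow> q \<le> p"
    using GreatestI_nat[of "\<lambda>p. p < m \<and> f \<in> J p" 0 m] Greatest_le_nat[of "\<lambda>p. p < m \<and> f \<in> J p" _ m] J_0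
    by (auto simp: p_def)
  have "f \<notin> J (Suc p)" using p p_max[of "Suc p"] \<open>f \<notin> J m\<close> by (cases "Suc p = m") auto
  then have "f \<in> F (int p)" "f \<notin> F (int p + 1)" using p by (auto simp: F_def nat_add_distrib)
  then obtain h q where h: "h \<in> F q" and prime: "prime_pair (f * h) (int p + q)"
    by (rule prime_multiple)
  obtain x n where xn: "(x, n) \<in> X"
    and eq: "\<And>i y. y \<in> F i \<Longrightarrow> f * h * y \<in> F (int p + q + i + 1) \<longleftrightarrow> x * y \<in> F (n + i + 1)"
    using X(2)[OF prime] by blast
  interpret P: prime_of_filtration J x n by (rule prime_of_filtrationI[OF X(1)[OF xn]])
  \<comment> \<open>Passing from degree 0 to degree p subtracts p e, and (m - p) e >= e
    remains.\<close>
  have "m * P.e \<le> P.ord f (int p) + p * P.e"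
    using ge[OF xn] P.ord_shift[OF f \<open>f \<in> F (int p)\<close>] by simp
  moreover have "m * P.e \<ge> Suc p * P.e" using p by (intro mult_right_mono) auto
  ultimately have "P.e \<le> P.ord f (int p)" by simp
  then have "f * x ^ P.e \<in> F (int P.e * (n + 1) + int p)"
    using P.ord_props(1)[OF f \<open>f \<in> F (int p)\<close>] by blast
  from F_mult[OF this h] have "f * h * x ^ P.e \<in> F (int p + q + (int P.e * (n + 1) - 1) + 1)"
    by (simp add: mult_ac add_ac)
  then show False using eq[OF P.u_power_unit(1)] P.u_power_unit(2) by blast
qed

end

subsection \<open>Valuations of the quotient field\<close>

lemma fract_cases_nonzero:
  fixes q :: "'a::idom fract"
  assumes "q \<noteq> 0"
  obtains a b where "a \<noteq> 0" "b \<noteq> 0" "q = to_fract a / to_fract b"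
  using Fract_cases_nonzero[of q] assms Fract_conv_to_fract by metis

lemma extend_valuation:
  fixes v :: "'a::idom \<Rightarrow> int"
  assumes mult: "\<And>a b. a \<noteq> 0 \<Longrightarrow> b \<noteq> 0 \<Longrightarrow> v (a * b) = v a + v b"
    and add: "\<And>a b. a \<noteq> 0 \<Longrightarrow> b \<noteq> 0 \<Longrightarrow> a + b \<noteq> 0 \<Longrightarrow> v (a + b) \<ge> min (v a) (v b)"
  obtains w where "valuation w" "\<And>a. a \<noteq> 0 \<Longrightarrow> w (to_fract a) = v a"
proof -
  define w where "w q = (SOME i. \<exists>a b. a \<noteq> 0 \<and> b \<noteq> 0 \<and> q = to_fract a / to_fract b \<and> i = v a - v b)" for q
  have w: "w (to_fract a / to_fract b) = v a - v b" if ab: "a \<noteq> 0" "b \<noteq> 0" for a b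
    unfolding w_def
  proof (rule some_equality)
    fix i assume "\<exists>a' b'. a' \<noteq> 0 \<and> b' \<noteq> 0 \<and> to_fract a / to_fract b = to_fract a' / to_fract b' \<and> i = v a' - v b'"
    then obtain c d where cd: "c \<noteq> 0" "d \<noteq> 0" "to_fract a / to_fract b = to_fract c / to_fract d" "i = v c - v d"
      by blast
    then have "to_fract (a * d) = to_fract (c * b)"
      using ab by (simp add: field_simps)
    then have "v (a * d) = v (c * b)" by (simp only: to_fract_eq_iff)
    then show "i = v a - v b" using mult ab cd by simp
  qed (use ab in blast)
  have "valuation w"
    unfolding valuation_def
  proof (intro conjI allI impI)
    fix x y :: "'a fract" assume xy: "x \<noteq> 0" "y \<noteq> 0"
    obtain a b where ab: "a \<noteq> 0" "b \<noteq> 0" "x = to_fract a / to_fract b"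
      using fract_cases_nonzero[OF xy(1)] .
    obtain c d where cd: "c \<noteq> 0" "d \<noteq> 0" "y = to_fract c / to_fract d"
      using fract_cases_nonzero[OF xy(2)] .
    have "x * y = to_fract (a * c) / to_fract (b * d)" using ab cd by simp
    also have "w \<dots> = v (a * c) - v (b * d)" by (rule w) (use ab cd in auto)
    finally show "w (x * y) = w x + w y" using w ab cd mult by simp
    assume "x + y \<noteq> 0"
    have eq: "x + y = to_fract (a * d + c * b) / to_fract (b * d)"
      using ab cd by (simp add: field_simps)
    then have "a * d + c * b \<noteq> 0" using \<open>x + y \<noteq> 0\<close> by (metis div_0 to_fract_0)
    then have "w (x + y) = v (a * d + c * b) - v (b * d)"
      unfolding eq by (rule w) (use ab cd in auto)
    moreover have "v (a * d + c * b) \<ge> min (v (a * d)) (v (c * b))"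
      using \<open>a * d + c * b \<noteq> 0\<close> ab cd add[of "a * d" "c * b"] by auto
    ultimately show "w (x + y) \<ge> min (w x) (w y)"
      using w ab cd mult by simp
  qed
  moreover have "w (to_fract a) = v a" if "a \<noteq> 0" for a
  proof -
    have "v 1 = 0" using mult[of 1 1] by simp
    then show ?thesis using w[OF that, of 1] by simp
  qed
  ultimately show ?thesis using that by blast
qed

lemma to_fract_power: "to_fract (x ^ n) = to_fract x ^ n"
  by (induction n) simp_all

lemma valuationD:
  assumes "valuation v"
  shows "x \<noteq> 0 \<Longrightarrow> y \<noteq> 0 \<Longrightarrow> v (x * y) = v x + v y"
    and "x \<noteq> 0 \<Longrightarrow> y \<noteq> 0 \<Longrightarrow> x + y \<noteq> 0 \<Longrightarrow> v (x + y) \<ge> min (v x) (v y)"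
  using assms by (auto simp: valuation_def)

lemma valuation_one: "valuation v \<Longrightarrow> v 1 = 0"
  using valuationD(1)[of v 1 1] by simp

lemma valuation_power: "valuation v \<Longrightarrow> x \<noteq> 0 \<Longrightarrow> v (x ^ n) = int n * v x"
  by (induction n) (simp_all add: valuation_one valuationD(1) distrib_right)

lemma valuation_inverse:
  assumes "valuation v" "x \<noteq> 0"
  shows "v (inverse x) = - v x"
  using valuationD(1)[OF assms(1), of x "inverse x"] valuation_one[OF assms(1)] assms(2) by simp

lemma valuation_divide:
  assumes "valuation v" "x \<noteq> 0" "y \<noteq> 0"
  shows "v (x / y) = v x - v y"
  using valuationD(1)[OF assms(1,2), of "inverse y"] valuation_inverse[OF assms(1,3)] assms(3)
  by (simp add: divide_inverse)

text \<open>The value group is d Z with d its least positive element: division with remainder would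
  otherwise yield a smaller positive value.\<close>

lemma normalize_valuation:
  fixes w :: "'k::field \<Rightarrow> int"
  assumes "valuation w" "z \<noteq> 0" "w z \<noteq> 0"
  obtains v d where "d > 0" "normalized_valuation v" "\<And>x. x \<noteq> 0 \<Longrightarrow> w x = d * v x"
proof -
  note val = valuationD[OF assms(1)] valuation_inverse[OF assms(1)] valuation_power[OF assms(1)]
  define d where "d = (LEAST k. k > 0 \<and> (\<exists>x. x \<noteq> 0 \<and> w x = int k))"
  have "\<exists>k>0. \<exists>x. x \<noteq> 0 \<and> w x = int k"
  proof (cases "w z > 0")
    case True
    then show ?thesis using assms(2) by (intro exI[of _ "nat (w z)"]) auto
  next
    case False
    then show ?thesis using assms(2,3) val(3)[of z]
      by (intro exI[of _ "nat (- w z)"] conjI exI[of _ "inverse z"]) auto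
  qed
  from LeastI_ex[OF this] obtain y where d: "d > 0" "y \<noteq> 0" "w y = int d"
    unfolding d_def by blast
  have least: "d \<le> k" if "k > 0" "x \<noteq> 0" "w x = int k" for k x
    unfolding d_def using that by (intro Least_le) blast
  have power: "\<exists>u. u \<noteq> 0 \<and> w u = k * int d" for k
  proof (cases "k \<ge> 0")
    case True
    then show ?thesis using val(4)[OF d(2), of "nat k"] d by (intro exI[of _ "y ^ nat k"]) auto
  next
    case False
    then show ?thesis using val(3)[of "y ^ nat (- k)"] val(4)[OF d(2), of "nat (- k)"] d
      by (intro exI[of _ "inverse (y ^ nat (- k))"]) auto
  qed
  have dvd: "int d dvd w x" if "x \<noteq> 0" for x
  proof (rule ccontr)
    assume "\<not> int d dvd w x"
    then have "w x mod int d \<noteq> 0" unfolding dvd_eq_mod_eq_0 .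
    then have "w x mod int d > 0" "w x mod int d < int d"
      using d(1) pos_mod_sign[of "int d" "w x"] pos_mod_bound[of "int d" "w x"] by linarith+
    moreover obtain u where "u \<noteq> 0" "w u = - (w x div int d) * int d" using power by blast
    then have "x * u \<noteq> 0" "w (x * u) = w x mod int d"
      using val(1)[OF that, of u] that by (simp_all add: minus_div_mult_eq_mod[symmetric])
    ultimately show False using least[of "nat (w x mod int d)" "x * u"] by simp
  qed
  define v where "v x = w x div int d" for x
  have v: "w x = int d * v x" if "x \<noteq> 0" for x
    using dvd[OF that] by (simp add: v_def)
  have "valuation v"
    unfolding valuation_def
  proof (intro conjI allI impI)
    fix x y :: 'k assume xy: "x \<noteq> 0" "y \<noteq> 0"
    have "int d * v (x * y) = int d * (v x + v y)"
      using val(1)[OF xy] v[of "x * y"] v xy by (simp add: distrib_left)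
    then show "v (x * y) = v x + v y" using d(1) by simp
    assume "x + y \<noteq> 0"
    then show "v (x + y) \<ge> min (v x) (v y)"
      using val(2)[OF xy] d(1) zdiv_mono1[of "w x" "w (x + y)" "int d"] zdiv_mono1[of "w y" "w (x + y)" "int d"]
      by (auto simp: v_def min_def split: if_splits)
  qed
  moreover have "k \<in> v ` (- {0})" for k
  proof -
    obtain u where "u \<noteq> 0" "w u = k * int d" using power by blast
    then show ?thesis using d(1) by (auto simp: v_def intro!: image_eqI[of _ _ u])
  qed
  ultimately have "normalized_valuation v" unfolding normalized_valuation_def by blast
  then show ?thesis using that[of "int d" v] v d(1) by simp
qed

definition nonneg_valuation :: "('a::idom fract \<Rightarrow> int) \<Rightarrow> bool"
  where "nonneg_valuation v \<longleftrightarrow> valuation v \<and> (\<forall>a. a \<noteq> 0 \<longrightarrow> v (to_fract a) \<ge> 0)"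

lemma valuation_ideal:
  assumes "nonneg_valuation v"
  shows "is_ideal {a. a = 0 \<or> v (to_fract a) \<ge> m}"
proof (rule idealI)
  have v: "valuation v" and nn: "\<And>a. a \<noteq> 0 \<Longrightarrow> v (to_fract a) \<ge> 0"
    using assms by (auto simp: nonneg_valuation_def)
  show "a + b \<in> {a. a = 0 \<or> v (to_fract a) \<ge> m}"
    if "a \<in> {a. a = 0 \<or> v (to_fract a) \<ge> m}" "b \<in> {a. a = 0 \<or> v (to_fract a) \<ge> m}" for a b
    using that valuationD(2)[OF v, of "to_fract a" "to_fract b"]
    by (cases "a = 0"; cases "b = 0"; cases "a + b = 0") (auto simp flip: to_fract_add)
  show "c * a \<in> {a. a = 0 \<or> v (to_fract a) \<ge> m}" if "a \<in> {a. a = 0 \<or> v (to_fract a) \<ge> m}" for a c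
    using that valuationD(1)[OF v, of "to_fract c" "to_fract a"] nn[of c]
    by (cases "a = 0"; cases "c = 0") auto
qed auto

lemma valuation_ideal_pow:
  assumes v: "nonneg_valuation v" and A: "\<And>x. x \<in> A \<Longrightarrow> x \<noteq> 0 \<Longrightarrow> v (to_fract x) \<ge> k"
  shows "ideal_pow A n \<subseteq> {a. a = 0 \<or> v (to_fract a) \<ge> int n * k}"
proof (induction n)
  case 0
  then show ?case using v by (auto simp: nonneg_valuation_def)
next
  case (Suc n)
  show ?case
    unfolding ideal_pow.simps
  proof (intro ideal_mult_minimal valuation_ideal[OF v])
    fix x y assume xy: "x \<in> A" "y \<in> ideal_pow A n"
    then show "x * y \<in> {a. a = 0 \<or> v (to_fract a) \<ge> int (Suc n) * k}"
      using Suc A[of x] valuationD(1)[of v "to_fract x" "to_fract y"] v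
      by (cases "x = 0"; cases "y = 0") (auto simp: nonneg_valuation_def distrib_right)
  qed
qed

lemma valuation_min:
  assumes "nonneg_valuation v" "x \<in> A" "x \<noteq> 0"
  obtains a where "a \<in> A" "a \<noteq> 0" "\<And>x. x \<in> A \<Longrightarrow> x \<noteq> 0 \<Longrightarrow> v (to_fract a) \<le> v (to_fract x)"
proof -
  obtain a where a: "a \<in> A \<and> a \<noteq> 0"
    "\<And>x. x \<in> A \<and> x \<noteq> 0 \<Longrightarrow> nat (v (to_fract a)) \<le> nat (v (to_fract x))"
    using ex_has_least_nat[of "\<lambda>x. x \<in> A \<and> x \<noteq> 0" x "\<lambda>x. nat (v (to_fract x))"] assms by blast
  have "v (to_fract a) \<le> v (to_fract x)" if "x \<in> A" "x \<noteq> 0" for x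
  proof -
    have "v (to_fract x) \<ge> 0" using that assms(1) by (simp add: nonneg_valuation_def)
    then show ?thesis using a(2)[of x] that by auto
  qed
  then show ?thesis using that a by blast
qed

text \<open>The bound comes from \<open>c * x ^ l \<in> A ^ (n * l)\<close> as \<open>l\<close> grows.\<close>

lemma valuation_integral_closure:
  assumes v: "nonneg_valuation v" and A: "\<And>x. x \<in> A \<Longrightarrow> x \<noteq> 0 \<Longrightarrow> v (to_fract x) \<ge> k"
    and "is_ideal A" "A \<noteq> {0}" "x \<in> ideal_integral_closure (ideal_pow A n)" "x \<noteq> 0"
  shows "v (to_fract x) \<ge> int n * k"
proof (rule ccontr)
  assume less: "\<not> ?thesis"
  obtain c where c: "c \<noteq> 0" "\<And>l. c * x ^ l \<in> ideal_pow A (n * l)"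
    using almost_integral_of_integral[OF assms(3-5)] by blast
  have val: "valuation v" using v by (simp add: nonneg_valuation_def)
  define l where "l = Suc (nat (v (to_fract c)))"
  have "c * x ^ l \<noteq> 0" using c assms by simp
  then have "v (to_fract (c * x ^ l)) \<ge> int (n * l) * k"
    using valuation_ideal_pow[OF v, of A k "n * l"] A c by blast
  moreover have "v (to_fract (c * x ^ l)) = v (to_fract c) + int l * v (to_fract x)"
    using c assms valuationD(1)[OF val] valuation_power[OF val] by (simp add: to_fract_power)
  moreover have "int l * (int n * k) \<ge> int l * (v (to_fract x) + 1)"
    using less by (intro mult_left_mono) auto
  moreover have "int l > v (to_fract c)" unfolding l_def by linarith
  ultimately show False by (simp add: algebra_simps)
qed

text \<open>Over a valuation ring the extension of A is principal, generated by an element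
  \<open>a\<close> of least value, so a single summand with coefficient y / a suffices.\<close>

lemma ideal_extension_valuation_ring:
  assumes v: "valuation v" and a: "a \<in> A" "a \<noteq> 0" "\<And>x. x \<in> A \<Longrightarrow> x \<noteq> 0 \<Longrightarrow> v (to_fract a) \<le> v (to_fract x)"
  shows "y \<in> ideal_extension A (valuation_ring v) \<longleftrightarrow> y = 0 \<or> v (to_fract a) \<le> v y"
proof
  assume "y = 0 \<or> v (to_fract a) \<le> v y"
  then have "y / to_fract a \<in> valuation_ring v"
    using valuation_divide[OF v, of y "to_fract a"] a(2) by (cases "y = 0") (auto simp: valuation_ring_def)
  moreover have "y = (\<Sum>x\<in>{a}. to_fract x * (y / to_fract a))" using a(2) by simp
  ultimately show "y \<in> ideal_extension A (valuation_ring v)"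
    unfolding ideal_extension_def using a(1)
    by (intro CollectI exI[of _ "{a}"] exI[of _ "\<lambda>_. y / to_fract a"]) simp
next
  assume "y \<in> ideal_extension A (valuation_ring v)"
  then obtain F c where F: "finite F" "F \<subseteq> A" "\<forall>x\<in>F. c x \<in> valuation_ring v"
    and y: "y = (\<Sum>x\<in>F. to_fract x * c x)"
    unfolding ideal_extension_def by blast
  show "y = 0 \<or> v (to_fract a) \<le> v y"
    using F unfolding y
  proof (induction F)
    case (insert x F)
    let ?s = "\<Sum>x\<in>F. to_fract x * c x" and ?t = "to_fract x * c x"
    have "?t = 0 \<or> v (to_fract a) \<le> v ?t"
      using insert.prems a(3)[of x] valuationD(1)[OF v, of "to_fract x" "c x"]
      by (cases "x = 0"; cases "c x = 0") (auto simp: valuation_ring_def)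
    then show ?case
      using insert valuationD(2)[OF v, of ?t ?s] by (cases "?t = 0"; cases "?s = 0"; cases "?t + ?s = 0") auto
  qed simp
qed

subsection \<open>Rees valuations\<close>

context prime_of_filtration
begin

lemma fract_valuation:
  obtains w where "valuation w" "\<And>a. a \<noteq> 0 \<Longrightarrow> w (to_fract a) = int (ord a 0)"
proof (rule extend_valuation[of "\<lambda>a. int (ord a 0)"])
  show "int (ord (a * b) 0) = int (ord a 0) + int (ord b 0)" if "a \<noteq> 0" "b \<noteq> 0" for a b
    using ord_mult[of a 0 b 0] that by (simp add: F_nonpos)
  show "min (int (ord a 0)) (int (ord b 0)) \<le> int (ord (a + b) 0)" if "a \<noteq> 0" "b \<noteq> 0" "a + b \<noteq> 0" for a b
    using ord_add[of a 0 b] that by (simp add: F_nonpos)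
qed (use that in blast)

end

context closed_filtration
begin

text \<open>Orders in degree 0 extend to valuations of K; \<open>ord_shift\<close> gives one
  direction and \<open>ord_representation\<close> the other. Each valuation is paired with the order
  of u at its prime, since it is not normalized yet.\<close>

lemma finite_valuations:
  "\<exists>P. finite P \<and> (\<forall>(w, e)\<in>P. nonneg_valuation w \<and> e > (0::nat)) \<and>
    (\<forall>m f. f \<in> J m \<longleftrightarrow> f = 0 \<or> (\<forall>(w, e)\<in>P. w (to_fract f) \<ge> int (m * e)))"
proof -
  obtain X where X: "finite X" "\<forall>(x, n)\<in>X. prime_pair x n"
    "\<forall>x n. prime_pair x n \<longrightarrow> (\<exists>(x', n')\<in>X. \<forall>m. \<forall>y\<in>F m.
      x * y \<in> F (n + m + 1) \<longleftrightarrow> x' * y \<in> F (n' + m + 1))"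
    using finitely_many_primes by (elim exE conjE)
  define ordX where "ordX c = prime_of_filtration.ord J (fst c) (snd c)" for c :: "'a \<times> int"
  define eX where "eX c = prime_of_filtration.e J (fst c) (snd c)" for c :: "'a \<times> int"
  have prime: "prime_of_filtration J (fst c) (snd c)" if "c \<in> X" for c
    using X(2) that prime_of_filtrationI by auto
  have "\<exists>w. valuation w \<and> (\<forall>a. a \<noteq> 0 \<longrightarrow> w (to_fract a) = int (ordX c a 0))" if "c \<in> X" for c
    using prime_of_filtration.fract_valuation[OF prime[OF that]] unfolding ordX_def by metis
  then obtain w where w: "\<And>c. c \<in> X \<Longrightarrow> valuation (w c)"
    "\<And>c a. c \<in> X \<Longrightarrow> a \<noteq> 0 \<Longrightarrow> w c (to_fract a) = int (ordX c a 0)"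
    by metis
  define P where "P = (\<lambda>c. (w c, eX c)) ` X"
  have ge: "f \<in> J m" if "f \<noteq> 0" "\<And>c. c \<in> X \<Longrightarrow> m * eX c \<le> ordX c f 0" for f m
  proof (rule ord_representation[OF _ _ that(1)])
    show "prime_pair x n" if "(x, n) \<in> X" for x n using X(2) that by blast
    show "\<exists>(x', n')\<in>X. \<forall>m. \<forall>y\<in>F m. x * y \<in> F (n + m + 1) \<longleftrightarrow> x' * y \<in> F (n' + m + 1)"
      if "prime_pair x n" for x n using X(3) that by blast
    show "m * prime_of_filtration.e J x n \<le> prime_of_filtration.ord J x n f 0" if "(x, n) \<in> X" for x n
      using \<open>\<And>c. c \<in> X \<Longrightarrow> m * eX c \<le> ordX c f 0\<close>[OF that] unfolding ordX_def eX_def by simp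
  qed
  have le: "m * eX c \<le> ordX c f 0" if "c \<in> X" "f \<noteq> 0" "f \<in> J m" for c f m
  proof -
    interpret Q: prime_of_filtration J "fst c" "snd c" by (rule prime[OF that(1)])
    show ?thesis using Q.ord_shift[OF that(2), of "int m"] that(3) by (simp add: F_def ordX_def eX_def)
  qed
  show ?thesis
  proof (intro exI[of _ P] conjI allI)
    show "finite P" using X(1) by (simp add: P_def)
    show "\<forall>(u, e)\<in>P. nonneg_valuation u \<and> e > 0"
      using w prime_of_filtration.e_pos[OF prime] by (auto simp: P_def nonneg_valuation_def eX_def)
    show "f \<in> J m \<longleftrightarrow> f = 0 \<or> (\<forall>(w, e)\<in>P. w (to_fract f) \<ge> int (m * e))" for m f
    proof (cases "f = 0")
      case True
      then show ?thesis using ideal_0[OF J_ideal] by simp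
    next
      case False
      then have "(\<forall>(w, e)\<in>P. w (to_fract f) \<ge> int (m * e)) \<longleftrightarrow> (\<forall>c\<in>X. m * eX c \<le> ordX c f 0)"
        using w by (auto simp: P_def simp del: of_nat_mult)
      then show ?thesis using ge le False by blast
    qed
  qed
qed

end

section \<open>Almost integral elements, and the closures of powers as a closed filtration\<close>

lemma integral_of_almost_integral:
  fixes A :: "'a::idom set"
  assumes "noetherian TYPE('a)" "is_ideal A" "z \<noteq> 0" and zx: "\<And>l. z * x ^ l \<in> ideal_pow A (n * l)"
  shows "x \<in> ideal_integral_closure (ideal_pow A n)"
proof -
  \<comment> \<open>Generators in degree m of the homogeneous ideal of the Rees algebra generated by
    z x^l t^(n l), l < j. Stability in j expresses z x^N through lower powers, and cancelling z
    leaves an equation of integral dependence.\<close>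
  define G where "G j m = {z * x ^ l * y | l y. l < j \<and> n * l \<le> m \<and> y \<in> ideal_pow A (m - n * l)}" for j m
  have "\<exists>j0. \<forall>j\<ge>j0. (\<lambda>m. ideal_gen (G j m)) = (\<lambda>m. ideal_gen (G j0 m))"
  proof (rule acc_graded[OF assms(1,2)])
    fix j m k
    show "is_ideal (ideal_gen (G j m))" by (rule ideal_gen_ideal)
    have "z * x ^ l * y \<in> ideal_pow A m" if "n * l \<le> m" "y \<in> ideal_pow A (m - n * l)" for l y
      using ideal_pow_add_mem[OF zx[of l] that(2)] that(1) by simp
    then show "ideal_gen (G j m) \<subseteq> ideal_pow A m"
      unfolding G_def by (intro ideal_gen_minimal ideal_ideal_pow) blast
    fix u w assume u: "u \<in> ideal_pow A m" and w: "w \<in> ideal_gen (G j k)"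
    have "ideal_gen (G j k) \<subseteq> {w. u * w \<in> ideal_gen (G j (m + k))}"
    proof (rule ideal_gen_minimal)
      show "is_ideal {w. u * w \<in> ideal_gen (G j (m + k))}"
        using ideal_gen_ideal[of "G j (m + k)"]
        by (intro idealI) (auto simp: ideal_0 distrib_left ideal_add mult.left_commute ideal_mult_left)
      show "G j k \<subseteq> {w. u * w \<in> ideal_gen (G j (m + k))}"
      proof
        fix g assume "g \<in> G j k"
        then obtain l y where l: "g = z * x ^ l * y" "l < j" "n * l \<le> k" "y \<in> ideal_pow A (k - n * l)"
          unfolding G_def by blast
        then have "u * y \<in> ideal_pow A (m + k - n * l)"
          using ideal_pow_add_mem[OF u l(4)] by simp
        then have "z * x ^ l * (u * y) \<in> G j (m + k)" using l unfolding G_def by fastforce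
        then show "g \<in> {w. u * w \<in> ideal_gen (G j (m + k))}"
          using l(1) ideal_gen_base by (fastforce simp: mult_ac)
      qed
    qed
    then show "u * w \<in> ideal_gen (G j (m + k))" using w by blast
  next
    fix j m
    have "G j m \<subseteq> G (Suc j) m" unfolding G_def by (blast intro: less_SucI)
    then show "ideal_gen (G j m) \<subseteq> ideal_gen (G (Suc j) m)"
      using ideal_gen_base by (intro ideal_gen_minimal ideal_gen_ideal) blast
  qed
  then obtain j0 where j0: "\<And>j m. j \<ge> j0 \<Longrightarrow> ideal_gen (G j m) = ideal_gen (G j0 m)" by metis
  \<comment> \<open>The equation must have degree at least 1.\<close>
  define N where "N = max j0 1"
  define C where "C = {r. \<exists>c. (\<forall>l<N. c l \<in> ideal_pow A (n * (N - l))) \<and> r = z * (\<Sum>l<N. c l * x ^ l)}"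
  have "z * x ^ N * 1 \<in> G (Suc N) (n * N)"
    unfolding G_def by (intro CollectI exI[of _ N] exI[of _ 1]) simp
  then have "z * x ^ N \<in> ideal_gen (G N (n * N))"
    using ideal_gen_base j0[of N] j0[of "Suc N"] by (fastforce simp: N_def)
  also have "\<dots> \<subseteq> C"
  proof (rule ideal_gen_minimal)
    show "is_ideal C"
    proof (rule idealI)
      show "0 \<in> C" unfolding C_def by (intro CollectI exI[of _ "\<lambda>_. 0"]) (simp add: ideal_0[OF ideal_ideal_pow])
      fix r d assume "r \<in> C"
      then obtain c where c: "\<forall>l<N. c l \<in> ideal_pow A (n * (N - l))" "r = z * (\<Sum>l<N. c l * x ^ l)"
        unfolding C_def by blast
      then show "d * r \<in> C" unfolding C_def 
        by (intro CollectI exI[of _ "\<lambda>l. d * c l"])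
          (simp add: sum_distrib_left mult_ac ideal_mult_left[OF ideal_ideal_pow])
      fix r' assume "r' \<in> C"
      then obtain c' where "\<forall>l<N. c' l \<in> ideal_pow A (n * (N - l))" "r' = z * (\<Sum>l<N. c' l * x ^ l)"
        unfolding C_def by blast
      then show "r + r' \<in> C" unfolding C_def using c
        by (intro CollectI exI[of _ "\<lambda>l. c l + c' l"])
          (simp add: distrib_left distrib_right sum.distrib ideal_add[OF ideal_ideal_pow])
    qed
    show "G N (n * N) \<subseteq> C"
    proof
      fix g assume "g \<in> G N (n * N)"
      then obtain l y where l: "g = z * x ^ l * y" "l < N" "y \<in> ideal_pow A (n * N - n * l)"
        unfolding G_def by blast
      have "(\<Sum>i<N. (if i = l then y else 0) * x ^ i) = (\<Sum>i<N. if i = l then y * x ^ l else 0)"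
        by (rule sum.cong) auto
      then have "g = z * (\<Sum>i<N. (if i = l then y else 0) * x ^ i)"
        using l by (simp add: mult_ac)
      then show "g \<in> C"
        unfolding C_def using l
        by (intro CollectI exI[of _ "\<lambda>i. if i = l then y else 0"])
          (simp add: diff_mult_distrib2 ideal_0[OF ideal_ideal_pow])
    qed
  qed
  finally obtain c where c: "\<forall>l<N. c l \<in> ideal_pow A (n * (N - l))" "z * x ^ N = z * (\<Sum>l<N. c l * x ^ l)"
    unfolding C_def by blast
  have "(\<Sum>i=1..N. c (N - i) * x ^ (N - i)) = (\<Sum>l<N. c l * x ^ l)"
    by (rule sum.reindex_bij_witness[of _ "\<lambda>l. N - l" "\<lambda>i. N - i"]) auto
  then have "x ^ N + (\<Sum>i=1..N. - c (N - i) * x ^ (N - i)) = 0"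
    using c(2) \<open>z \<noteq> 0\<close> by (simp add: sum_negf)
  moreover have "\<forall>i\<in>{1..N}. - c (N - i) \<in> ideal_pow (ideal_pow A n) i"
  proof
    fix i assume "i \<in> {1..N}"
    then have "N - i < N" "N - (N - i) = i" by auto
    then show "- c (N - i) \<in> ideal_pow (ideal_pow A n) i"
      using c(1) ideal_neg[OF ideal_ideal_pow] unfolding ideal_pow_pow by metis
  qed
  moreover have "N \<ge> 1" by (simp add: N_def)
  ultimately show ?thesis unfolding ideal_integral_closure_def
    by (intro CollectI exI[of _ N] conjI exI[of _ "\<lambda>i. - c (N - i)"])
qed

text \<open>\<open>c\<close> is the largest degree of a module generator: in a combination of
  generators, the coefficient at n + c receives nonzero contributions only from coefficients of the
  scalars in degrees >= n.\<close>

lemma closure_shift: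
  fixes A :: "'a::comm_ring_1 set"
  assumes "finitely_generated_module (rees_algebra (ideal_pow A)) (rees_algebra J)"
    and "\<And>n. 0 \<in> J n"
  obtains c where "\<And>n. J (n + c) \<subseteq> ideal_pow A n"
proof -
  obtain G where G: "finite G"
    "rees_algebra J = {\<Sum>g\<in>G. c g * g | c. \<forall>g\<in>G. c g \<in> rees_algebra (ideal_pow A)}"
    using assms(1) unfolding finitely_generated_module_def by blast
  define d where "d = Max (insert 0 (degree ` G))"
  have d: "degree g \<le> d" if "g \<in> G" for g using that G(1) by (simp add: d_def)
  have "y \<in> ideal_pow A n" if y: "y \<in> J (n + d)" for y n
  proof -
    have "Polynomial.monom y (n + d) \<in> rees_algebra J"
      using y assms(2) by (simp add: rees_algebra_def)
    then obtain c where c: "\<forall>g\<in>G. c g \<in> rees_algebra (ideal_pow A)"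
      "Polynomial.monom y (n + d) = (\<Sum>g\<in>G. c g * g)"
      unfolding G by blast
    have "y = coeff (\<Sum>g\<in>G. c g * g) (n + d)" using c(2) by (metis coeff_monom)
    also have "\<dots> = (\<Sum>g\<in>G. \<Sum>i\<le>n + d. coeff (c g) i * coeff g (n + d - i))"
      by (simp add: coeff_sum coeff_mult)
    also have "\<dots> \<in> ideal_pow A n"
    proof (intro ideal_sum ideal_ideal_pow)
      fix g i assume g: "g \<in> G" and "i \<in> {..n + d}"
      show "coeff (c g) i * coeff g (n + d - i) \<in> ideal_pow A n"
      proof (cases "i \<ge> n")
        case True
        then have "coeff (c g) i \<in> ideal_pow A n"
          using c(1) g ideal_pow_antimono[of n i A] by (auto simp: rees_algebra_def)
        then show ?thesis by (rule ideal_mult_right[OF ideal_ideal_pow])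
      next
        case False
        then have "coeff g (n + d - i) = 0" using d[OF g] by (intro coeff_eq_0) simp
        then show ?thesis using ideal_0[OF ideal_ideal_pow] by simp
      qed
    qed
    finally show ?thesis .
  qed
  then show ?thesis using that[of d] by blast
qed

text \<open>With closures described by a common denominator, sums and products are handled without
  equations of integral dependence; \<open>shift\<close> supplies the last two axioms of the
  locale.\<close>

lemma closed_filtration_closures:
  fixes A :: "'a::idom set"
  assumes noeth: "noetherian TYPE('a)" and A: "is_ideal A" "A \<noteq> {0}"
    and shift: "\<And>n. ideal_integral_closure (ideal_pow A (n + c)) \<subseteq> ideal_pow A n"
  shows "closed_filtration (\<lambda>n. ideal_integral_closure (ideal_pow A n))"
proof -
  define J where "J n = ideal_integral_closure (ideal_pow A n)" for n
  have J: "x \<in> J n \<longleftrightarrow> (\<exists>z. z \<noteq> 0 \<and> (\<forall>l. z * x ^ l \<in> ideal_pow A (n * l)))" for x n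
    unfolding J_def using almost_integral_of_integral[OF A] integral_of_almost_integral[OF noeth A(1)]
    by metis
  have sub: "ideal_pow A n \<subseteq> J n" for n
    unfolding J_def by (intro subset_ideal_integral_closure ideal_ideal_pow)
  have shift': "J (n + c) \<subseteq> ideal_pow A n" for n using shift by (simp add: J_def)
  have mult: "x * y \<in> J (m + n)" if x: "x \<in> J m" and y: "y \<in> J n" for x y m n
  proof -
    obtain z where z: "z \<noteq> 0" "\<And>l. z * x ^ l \<in> ideal_pow A (m * l)" using x J by blast
    obtain w where w: "w \<noteq> 0" "\<And>l. w * y ^ l \<in> ideal_pow A (n * l)" using y J by blast
    have "z * w * (x * y) ^ l \<in> ideal_pow A ((m + n) * l)" for l
      using ideal_pow_add_mem[OF z(2)[of l] w(2)[of l]] by (simp add: power_mult_distrib mult_ac distrib_left)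
    then show ?thesis using z w J by (metis mult_eq_0_iff)
  qed
  have add: "x + y \<in> J n" if x: "x \<in> J n" and y: "y \<in> J n" for x y n
  proof -
    obtain z where z: "z \<noteq> 0" "\<And>l. z * x ^ l \<in> ideal_pow A (n * l)" using x J by blast
    obtain w where w: "w \<noteq> 0" "\<And>l. w * y ^ l \<in> ideal_pow A (n * l)" using y J by blast
    have "z * w * (x + y) ^ l \<in> ideal_pow A (n * l)" for l
    proof -
      have "z * w * (x + y) ^ l = (\<Sum>i\<le>l. of_nat (l choose i) * (z * x ^ i * (w * y ^ (l - i))))"
        by (simp add: binomial_ring sum_distrib_left mult_ac)
      also have "\<dots> \<in> ideal_pow A (n * l)"
      proof (intro ideal_sum[OF ideal_ideal_pow] ideal_mult_left[OF ideal_ideal_pow, of _ _ _ "of_nat _"])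
        fix i assume "i \<in> {..l}"
        then have "n * i + n * (l - i) = n * l" by (simp flip: distrib_left)
        then show "z * x ^ i * (w * y ^ (l - i)) \<in> ideal_pow A (n * l)"
          using ideal_pow_add_mem[OF z(2)[of i] w(2)[of "l - i"]] by simp
      qed
      finally show ?thesis .
    qed
    then show ?thesis using z w J by (metis mult_eq_0_iff)
  qed
  have ideal: "is_ideal (J n)" for n
  proof (rule idealI)
    show "0 \<in> J n" using sub ideal_0[OF ideal_ideal_pow] by blast
    show "d * x \<in> J n" if "x \<in> J n" for d x
      using mult[of d 0 x n] that sub[of 0] by auto
  qed (rule add)
  obtain a where a: "a \<in> A" "a \<noteq> 0" using ideal_nonzero_mem[OF A] .
  \<comment> \<open>\<open>d\<close> lies in J c, so it moves J n into J (n + c) and thus into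
    A^n.\<close>
  define d where "d = a ^ c"
  have d: "d \<noteq> 0" "d \<in> J c" using a sub power_in_ideal_pow[of a A c] by (auto simp: d_def)
  have dJ: "d * x \<in> ideal_pow A n" if "x \<in> J n" for x n
    using mult[OF d(2) that] shift'[of n] by (auto simp: add.commute)
  have "closed_filtration J"
  proof
    show "J 0 = UNIV" using sub[of 0] by auto
    show "is_ideal (J n)" for n by (rule ideal)
    show "J (Suc n) \<subseteq> J n" for n
      unfolding J_def using ideal_pow_antimono[of n "Suc n" A] by (intro ideal_integral_closure_mono) simp
    show "x * y \<in> J (m + n)" if "x \<in> J m" "y \<in> J n" for x y m n by (rule mult[OF that])
    show "\<exists>x\<in>J n. x \<noteq> 0" for n
      using sub[of n] power_in_ideal_pow[OF a(1), of n] a(2) by (intro bexI[of _ "a ^ n"]) auto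
    show "x \<in> J n" if "z \<noteq> 0" and "\<And>l. z * x ^ l \<in> J (n * l)" for x z n
    proof -
      have "d * z * x ^ l \<in> ideal_pow A (n * l)" for l using dJ[OF that(2)[of l]] by (simp add: mult_ac)
      then show ?thesis using J that(1) d(1) by (metis mult_eq_0_iff)
    qed
    show "\<exists>j0. \<forall>j\<ge>j0. U j = U j0"
      if U: "\<And>j m. is_ideal (U j m)" "\<And>j m. U j m \<subseteq> J m"
        "\<And>j m n x y. x \<in> J m \<Longrightarrow> y \<in> U j n \<Longrightarrow> x * y \<in> U j (m + n)" "\<And>j m. U j m \<subseteq> U (Suc j) m"
      for U :: "nat \<Rightarrow> nat \<Rightarrow> 'a set"
    proof -
      \<comment> \<open>Multiplication by \<open>d\<close> is injective and turns the given chain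
        into a chain of homogeneous ideals of the Rees algebra of A.\<close>
      have "\<exists>j0. \<forall>j\<ge>j0. (\<lambda>m. (*) d ` U j m) = (\<lambda>m. (*) d ` U j0 m)"
      proof (rule acc_graded[OF noeth A(1)])
        fix j m n
        show "is_ideal ((*) d ` U j m)"
        proof (rule idealI)
          show "0 \<in> (*) d ` U j m" using ideal_0[OF U(1)[of j m]] by force
          show "x + y \<in> (*) d ` U j m" if "x \<in> (*) d ` U j m" "y \<in> (*) d ` U j m" for x y
            using that ideal_add[OF U(1)[of j m]] by (auto simp flip: distrib_left)
          show "r * x \<in> (*) d ` U j m" if "x \<in> (*) d ` U j m" for x r
            using that ideal_mult_left[OF U(1)[of j m]] by (auto simp: mult.left_commute)
        qed
        show "(*) d ` U j m \<subseteq> ideal_pow A m" using U(2) dJ by blast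
        show "x * y \<in> (*) d ` U j (m + n)" if x: "x \<in> ideal_pow A m" and y: "y \<in> (*) d ` U j n" for x y
        proof -
          obtain w where w: "w \<in> U j n" "y = d * w" using y by blast
          then have "x * w \<in> U j (m + n)" using U(3) x sub by blast
          then show ?thesis using w(2) by (auto intro!: image_eqI[of _ _ "x * w"])
        qed
        show "(*) d ` U j m \<subseteq> (*) d ` U (Suc j) m" using U(4) by blast
      qed
      then obtain j0 where j0: "\<And>j m. j \<ge> j0 \<Longrightarrow> (*) d ` U j m = (*) d ` U j0 m" by metis
      have "inj ((*) d)" using d(1) by (auto intro: injI)
      then have "U j m = U j0 m" if "j \<ge> j0" for j m using j0[OF that] by (simp add: inj_image_eq_iff)
      then show ?thesis by blast
    qed
  qed
  then show ?thesis unfolding J_def .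
qed

lemma one_in_integral_closure:
  fixes A :: "'a::comm_ring_1 set"
  assumes "is_ideal A" "1 \<in> ideal_integral_closure A"
  shows "A = UNIV"
proof -
  obtain n c where c: "\<forall>i\<in>{1..n}. c i \<in> ideal_pow A i" "1 ^ n + (\<Sum>i=1..n. c i * 1 ^ (n - i)) = (0::'a)"
    using assms(2) unfolding ideal_integral_closure_def by blast
  have "(\<Sum>i=1..n. c i * 1 ^ (n - i)) \<in> A"
  proof (intro ideal_sum assms(1))
    fix i assume "i \<in> {1..n}"
    then show "c i * 1 ^ (n - i) \<in> A"
      using c(1) ideal_pow_antimono[of 1 i A] ideal_pow_1[OF assms(1)] by auto
  qed
  then have "1 \<in> A" using c(2) ideal_neg[OF assms(1)] by (metis add.commute add_eq_0_iff power_one)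
  then show ?thesis using ideal_mult_right[OF assms(1), of 1] by auto
qed

text \<open>The normalized valuations from \<open>finite_valuations\<close> represent all closures,
  and a representing subfamily of least cardinality is irredundant. The constant \<open>e v\<close>,
  the least value of v on A, takes over the role of the order of u.\<close>

theorem rees_valuations_exist:
  fixes A :: "'a::idom set"
  assumes noeth: "noetherian TYPE('a)" and A: "is_ideal A" "A \<noteq> {0}" "A \<noteq> UNIV"
    and shift: "\<And>n. ideal_integral_closure (ideal_pow A (n + c)) \<subseteq> ideal_pow A n"
  shows "\<exists>VS (e :: ('a fract \<Rightarrow> int) \<Rightarrow> int). finite VS \<and> VS \<noteq> {} \<and>
    (\<forall>v\<in>VS. rees_valuation A v \<and> nonneg_valuation v \<and> e v > 0 \<and>
      (\<exists>a\<in>A. a \<noteq> 0 \<and> v (to_fract a) = e v) \<and> (\<forall>a\<in>A. a \<noteq> 0 \<longrightarrow> e v \<le> v (to_fract a))) \<and>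
    (\<forall>n x. x \<in> ideal_integral_closure (ideal_pow A n) \<longleftrightarrow>
      x = 0 \<or> (\<forall>v\<in>VS. v (to_fract x) \<ge> int n * e v))"
proof -
  define J where "J n = ideal_integral_closure (ideal_pow A n)" for n
  interpret J: closed_filtration J
    unfolding J_def by (rule closed_filtration_closures[OF noeth A(1,2) shift])
  obtain P where P: "finite P" "\<forall>(w, e)\<in>P. nonneg_valuation w \<and> e > (0::nat)"
    "\<forall>m f. f \<in> J m \<longleftrightarrow> f = 0 \<or> (\<forall>(w, e)\<in>P. w (to_fract f) \<ge> int (m * e))"
    using J.finite_valuations by (elim exE conjE)
  have AJ: "A \<subseteq> J 1"
    unfolding J_def ideal_pow_1[OF A(1)] by (rule subset_ideal_integral_closure[OF A(1)])
  obtain a where a: "a \<in> A" "a \<noteq> 0" using ideal_nonzero_mem[OF A(1,2)] .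
  define good where "good v \<longleftrightarrow> normalized_valuation v \<and> nonneg_valuation v \<and>
    (\<forall>x\<in>A. x \<noteq> 0 \<longrightarrow> v (to_fract x) > 0)" for v
  have "\<exists>v d. good v \<and> d > 0 \<and> (\<forall>x. x \<noteq> 0 \<longrightarrow> fst p x = d * v x)" if p: "p \<in> P" for p
  proof -
    obtain w e where we: "p = (w, e)" by (cases p)
    have w: "nonneg_valuation w" "e > 0" using P(2) p we by auto
    have pos: "w (to_fract x) > 0" if "x \<in> A" "x \<noteq> 0" for x
    proof -
      have "w (to_fract x) \<ge> int (1 * e)" using P(3)[rule_format, of x 1] AJ that p we by auto
      then show ?thesis using w(2) by simp
    qed
    obtain v d where vd: "d > 0" "normalized_valuation v" "\<And>x. x \<noteq> 0 \<Longrightarrow> w x = d * v x"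
      using normalize_valuation[of w "to_fract a"] w(1) pos[OF a] a(2)
      by (metis nonneg_valuation_def less_irrefl to_fract_eq_0_iff)
    have sgn: "v x \<ge> 0 \<longleftrightarrow> w x \<ge> 0" "v x > 0 \<longleftrightarrow> w x > 0" if "x \<noteq> 0" for x
      using vd(1,3) that by (simp_all add: zero_le_mult_iff zero_less_mult_iff)
    have "good v"
      unfolding good_def nonneg_valuation_def
      using vd(2) w(1) pos sgn by (auto simp: nonneg_valuation_def normalized_valuation_def)
    then show ?thesis using vd we by auto
  qed
  then obtain V d where V: "\<And>p. p \<in> P \<Longrightarrow> good (V p)" "\<And>p. p \<in> P \<Longrightarrow> d p > 0"
    "\<And>p x. p \<in> P \<Longrightarrow> x \<noteq> 0 \<Longrightarrow> fst p x = d p * V p x"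
    by metis
  define VR where "VR = valuation_ring ` V ` P"
  have contraction: "\<exists>b\<in>A. b \<noteq> 0 \<and> (\<forall>x\<in>A. x \<noteq> 0 \<longrightarrow> v (to_fract b) \<le> v (to_fract x)) \<and>
      (\<forall>n x. to_fract x \<in> ideal_extension (ideal_pow A n) (valuation_ring v) \<longleftrightarrow>
        x = 0 \<or> int n * v (to_fract b) \<le> v (to_fract x))" if v: "nonneg_valuation v" for v
  proof -
    obtain b where b: "b \<in> A" "b \<noteq> 0" "\<And>x. x \<in> A \<Longrightarrow> x \<noteq> 0 \<Longrightarrow> v (to_fract b) \<le> v (to_fract x)"
      using valuation_min[OF v a] by blast
    have val: "valuation v" using v by (simp add: nonneg_valuation_def)
    have "to_fract x \<in> ideal_extension (ideal_pow A n) (valuation_ring v) \<longleftrightarrow>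
        x = 0 \<or> int n * v (to_fract b) \<le> v (to_fract x)" for n x
    proof -
      have bn: "v (to_fract (b ^ n)) = int n * v (to_fract b)"
        using valuation_power[OF val] b(2) by (simp add: to_fract_power)
      have "v (to_fract (b ^ n)) \<le> v (to_fract y)" if "y \<in> ideal_pow A n" "y \<noteq> 0" for y
        using valuation_ideal_pow[OF \<open>nonneg_valuation v\<close> b(3), of A n] that bn by auto
      then show ?thesis
        using ideal_extension_valuation_ring[OF val power_in_ideal_pow[OF b(1), of n], of "to_fract x"] b(2) bn
        by simp
    qed
    then show ?thesis using b by blast
  qed
  have "represents_closures A VR"
    unfolding represents_closures_def
  proof (intro conjI ballI allI impI)
    show "finite VR" using P(1) by (simp add: VR_def)
    fix R assume "R \<in> VR"
    then obtain p where p: "p \<in> P" "R = valuation_ring (V p)" by (auto simp: VR_def)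
    then show "dvr_of_field R" using V(1) unfolding dvr_of_field_def good_def by blast
    show "range to_fract \<subseteq> R"
      using V(1)[OF p(1)] p(2) by (auto simp: valuation_ring_def good_def nonneg_valuation_def)
  next
    fix n :: nat
    show "ideal_integral_closure (ideal_pow A n) =
        (\<Inter>R\<in>VR. {x. to_fract x \<in> ideal_extension (ideal_pow A n) R})"
    proof (intro set_eqI iffI)
      fix x assume x: "x \<in> ideal_integral_closure (ideal_pow A n)"
      have "to_fract x \<in> ideal_extension (ideal_pow A n) (valuation_ring (V p))" if "p \<in> P" for p
      proof -
        have nn: "nonneg_valuation (V p)" using V(1)[OF that] by (simp add: good_def)
        obtain b where b: "\<forall>x\<in>A. x \<noteq> 0 \<longrightarrow> V p (to_fract b) \<le> V p (to_fract x)"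
          "\<And>x. to_fract x \<in> ideal_extension (ideal_pow A n) (valuation_ring (V p)) \<longleftrightarrow>
            x = 0 \<or> int n * V p (to_fract b) \<le> V p (to_fract x)"
          using contraction[OF nn] by blast
        show ?thesis
          using b valuation_integral_closure[OF nn, of A "V p (to_fract b)" x n] A x by blast
      qed
      then show "x \<in> (\<Inter>R\<in>VR. {x. to_fract x \<in> ideal_extension (ideal_pow A n) R})"
        by (auto simp: VR_def)
    next
      fix x assume x: "x \<in> (\<Inter>R\<in>VR. {x. to_fract x \<in> ideal_extension (ideal_pow A n) R})"
      have "int (n * snd p) \<le> fst p (to_fract x)" if "p \<in> P" "x \<noteq> 0" for p
      proof -
        have nn: "nonneg_valuation (V p)" using V(1)[OF that(1)] by (simp add: good_def)
        obtain b where b: "b \<in> A" "b \<noteq> 0"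
          "\<And>x. to_fract x \<in> ideal_extension (ideal_pow A n) (valuation_ring (V p)) \<longleftrightarrow>
            x = 0 \<or> int n * V p (to_fract b) \<le> V p (to_fract x)"
          using contraction[OF nn] by blast
        have "int n * V p (to_fract b) \<le> V p (to_fract x)"
          using x b(3)[of x] that by (auto simp: VR_def)
        then have "d p * (int n * V p (to_fract b)) \<le> d p * V p (to_fract x)"
          using V(2)[OF that(1)] by (intro mult_left_mono) auto
        then have "int n * fst p (to_fract b) \<le> fst p (to_fract x)"
          using V(3)[OF that(1)] b(2) that(2) by (simp add: mult_ac)
        \<comment> \<open>A is contained in J 1, so the least value on A is at least the order of u;
          the inequality for the former implies the one that defines J n.\<close>
        moreover have "int (1 * snd p) \<le> fst p (to_fract b)"
          using P(3)[rule_format, of b 1] AJ b(1,2) that(1) by (cases p) auto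
        then have "int n * int (snd p) \<le> int n * fst p (to_fract b)" by (intro mult_left_mono) auto
        ultimately show ?thesis by simp
      qed
      then have "x \<in> J n" using P(3) by auto
      then show "x \<in> ideal_integral_closure (ideal_pow A n)" by (simp add: J_def)
    qed
  qed
  then obtain W where W: "W \<subseteq> VR" "represents_closures A W"
    and min: "\<And>W'. W' \<subseteq> VR \<Longrightarrow> represents_closures A W' \<Longrightarrow> card W \<le> card W'"
    using ex_has_least_nat[of "\<lambda>W. W \<subseteq> VR \<and> represents_closures A W" VR card] by blast
  have finW: "finite W" using W(2) by (simp add: represents_closures_def)
  have rees: "rees_valuation_rings A W"
    unfolding rees_valuation_rings_def using W min psubset_card_mono[OF finW] by (meson leD psubset_imp_subset subset_trans)
  have "\<exists>v. good v \<and> R = valuation_ring v" if "R \<in> W" for R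
    using that W(1) V(1) unfolding VR_def by blast
  then obtain v where v: "\<And>R. R \<in> W \<Longrightarrow> good (v R)" "\<And>R. R \<in> W \<Longrightarrow> valuation_ring (v R) = R"
    by metis
  define is_min where "is_min u b \<longleftrightarrow> b \<in> A \<and> b \<noteq> 0 \<and> (\<forall>x\<in>A. x \<noteq> 0 \<longrightarrow> u (to_fract b) \<le> u (to_fract x)) \<and>
      (\<forall>n x. to_fract x \<in> ideal_extension (ideal_pow A n) (valuation_ring u) \<longleftrightarrow>
        x = 0 \<or> int n * u (to_fract b) \<le> u (to_fract x))" for u b
  have "\<exists>b. is_min u b" if "u \<in> v ` W" for u
  proof -
    have "nonneg_valuation u" using v(1) that by (auto simp: good_def)
    from contraction[OF this] show ?thesis unfolding is_min_def by blast
  qed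
  then obtain b where "\<And>u. u \<in> v ` W \<Longrightarrow> is_min u (b u)" by metis
  then have b: "\<And>u. u \<in> v ` W \<Longrightarrow> b u \<in> A" "\<And>u. u \<in> v ` W \<Longrightarrow> b u \<noteq> 0"
    "\<And>u x. u \<in> v ` W \<Longrightarrow> x \<in> A \<Longrightarrow> x \<noteq> 0 \<Longrightarrow> u (to_fract (b u)) \<le> u (to_fract x)"
    "\<And>u n x. u \<in> v ` W \<Longrightarrow> to_fract x \<in> ideal_extension (ideal_pow A n) (valuation_ring u) \<longleftrightarrow>
        x = 0 \<or> int n * u (to_fract (b u)) \<le> u (to_fract x)"
    unfolding is_min_def by blast+
  show ?thesis
  proof (intro exI[of _ "v ` W"] exI[of _ "\<lambda>u. u (to_fract (b u))"] conjI ballI allI impI)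
    show "finite (v ` W)" using finW by simp
    show "v ` W \<noteq> {}"
    proof
      assume "v ` W = {}"
      then have "ideal_integral_closure (ideal_pow A 1) = UNIV"
        using W(2) by (auto simp: represents_closures_def)
      then show False using one_in_integral_closure[OF A(1)] A(3) ideal_pow_1[OF A(1)] by auto
    qed
    fix u assume u: "u \<in> v ` W"
    show "rees_valuation A u" using u rees v by (auto simp: rees_valuation_def good_def)
    show "nonneg_valuation u" using u v by (auto simp: good_def)
    show "u (to_fract (b u)) > 0" using u v b(1,2)[OF u] by (auto simp: good_def)
    show "\<exists>a\<in>A. a \<noteq> 0 \<and> u (to_fract a) = u (to_fract (b u))" using b(1,2)[OF u] by blast
    show "u (to_fract (b u)) \<le> u (to_fract a)" if "a \<in> A" "a \<noteq> 0" for a using b(3)[OF u that] .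
  next
    show "x \<in> ideal_integral_closure (ideal_pow A n) \<longleftrightarrow>
      x = 0 \<or> (\<forall>u\<in>v ` W. u (to_fract x) \<ge> int n * u (to_fract (b u)))" for n x
    \<comment> \<open>\<open>represents_closures\<close> speaks of n >= 1; at n = 0 both sides hold
      for every x.\<close>
    proof (cases "n = 0")
      case True
      have "x = 0 \<or> (\<forall>u\<in>v ` W. u (to_fract x) \<ge> 0)"
        using v(1) by (auto simp: good_def nonneg_valuation_def)
      moreover have "x \<in> ideal_integral_closure (ideal_pow A 0)" using J.J_0 by (simp add: J_def)
      ultimately show ?thesis using True by simp
    next
      case False
      then have "ideal_integral_closure (ideal_pow A n) =
          (\<Inter>R\<in>W. {x. to_fract x \<in> ideal_extension (ideal_pow A n) R})"
        using W(2) by (auto simp: represents_closures_def)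
      also have "\<dots> = (\<Inter>u\<in>v ` W. {x. to_fract x \<in> ideal_extension (ideal_pow A n) (valuation_ring u)})"
        using v(2) by auto
      finally show ?thesis using b(4) by auto
    qed
  qed
qed

subsection \<open>Limits\<close>

text \<open>Fekete's argument with a threshold: f is controlled only from \<open>N\<close> on, so
  the remainder of the division by \<open>m\<close> is shifted to lie in M .. M + m, where it costs
  at most \<open>C\<close>.\<close>

lemma fekete:
  fixes f :: "nat \<Rightarrow> real"
  assumes nonneg: "\<And>n. n \<ge> N \<Longrightarrow> f n \<ge> 0"
    and sub: "\<And>p q. p \<ge> N \<Longrightarrow> q \<ge> N \<Longrightarrow> f (p + q) \<le> f p + f q"
  obtains L where "L \<ge> 0" "(\<lambda>n. f n / real n) \<longlonglongrightarrow> L"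
proof -
  define M where "M = max N 1"
  define S where "S = (\<lambda>n. f n / real n) ` {M..}"
  define L where "L = Inf S"
  have bdd: "bdd_below S"
    using nonneg by (intro bdd_belowI[of _ 0]) (auto simp: S_def M_def)
  have "S \<noteq> {}" by (auto simp: S_def)
  have "L \<ge> 0"
    unfolding L_def using nonneg \<open>S \<noteq> {}\<close> by (intro cInf_greatest) (auto simp: S_def M_def)
  have "(\<lambda>n. f n / real n) \<longlonglongrightarrow> L"
  proof (rule LIMSEQ_I)
    fix r :: real assume "r > 0"
    then have "Inf S < L + r / 2" by (simp add: L_def)
    then obtain m where m: "m \<ge> M" "f m / real m < L + r / 2"
      using cInf_lessD[OF \<open>S \<noteq> {}\<close>] by (auto simp: S_def)
    have "m > 0" using m by (simp add: M_def)
    define C where "C = Max (f ` {M..M + m})"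
    have C: "f i \<le> C" if "i \<in> {M..M + m}" for i using that by (simp add: C_def)
    have "C \<ge> 0" using C[of M] nonneg[of M] by (force simp: M_def)
    have mult: "f (q * m + i) \<le> real q * f m + f i" if "i \<ge> M" for q i
    proof (induction q)
      case (Suc q)
      have "f (m + (q * m + i)) \<le> f m + f (q * m + i)"
        using sub[of m "q * m + i"] m that by (auto simp: M_def)
      then show ?case using Suc by (simp add: algebra_simps)
    qed simp
    obtain n0 where n0: "real n0 > 2 * C / r" using reals_Archimedean2 by blast
    have "norm (f n / real n - L) < r" if n: "n \<ge> max M (Suc n0)" for n
    proof -
      define q i where "q = (n - M) div m" and "i = M + (n - M) mod m"
      have eq: "n = q * m + i" using n by (simp add: q_def i_def)
      have "i \<in> {M..M + m}" using \<open>m > 0\<close> by (simp add: i_def less_imp_le)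
      then have "f n \<le> real q * f m + C" using mult[of i q] C[of i] eq by auto
      also have "real q * f m = (f m / real m) * (real q * real m)" using \<open>m > 0\<close> by simp
      also have "\<dots> \<le> (f m / real m) * real n"
        using nonneg[of m] m eq by (intro mult_left_mono) (auto simp: M_def simp flip: of_nat_mult)
      finally have "f n / real n \<le> f m / real m + C / real n"
        using n by (simp add: field_simps)
      moreover have "C / real n < r / 2"
      proof -
        have "real n0 < real n" using n by simp
        then have "2 * C / r < real n" using n0 by linarith
        then show ?thesis using \<open>r > 0\<close> n by (simp add: field_simps)
      qed
      moreover have "L \<le> f n / real n"
        unfolding L_def using n by (intro cInf_lower bdd) (auto simp: S_def)
      ultimately have "L \<le> f n / real n" "f n / real n < L + r" using m by linarith+
      then show ?thesis by simp
    qed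
    then show "\<exists>n0. \<forall>n\<ge>n0. norm (f n / real n - L) < r" by blast
  qed
  then show ?thesis using that \<open>L \<ge> 0\<close> by blast
qed

lemma tendsto_Min:
  fixes f :: "'i \<Rightarrow> 'b \<Rightarrow> real"
  assumes "finite I" "I \<noteq> {}" "\<And>i. i \<in> I \<Longrightarrow> (f i \<longlongrightarrow> l i) F"
  shows "((\<lambda>n. Min ((\<lambda>i. f i n) ` I)) \<longlongrightarrow> Min (l ` I)) F"
  using assms
proof (induction I rule: finite_ne_induct)
  case (insert i I)
  then have "((\<lambda>n. min (f i n) (Min ((\<lambda>i. f i n) ` I))) \<longlongrightarrow> min (l i) (Min (l ` I))) F"
    by (intro tendsto_min) auto
  then show ?case using insert by simp
qed simp

lemma tendsto_ereal_quotient: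
  fixes \<beta> :: "nat \<Rightarrow> ereal" and l h :: "nat \<Rightarrow> real"
  assumes "\<forall>\<^sub>F n in sequentially. ereal (l n) \<le> \<beta> n \<and> \<beta> n \<le> ereal (h n)"
    and "(\<lambda>n. l n / real n) \<longlonglongrightarrow> L" "(\<lambda>n. h n / real n) \<longlonglongrightarrow> L"
  shows "(\<lambda>n. \<beta> n / ereal (real n)) \<longlonglongrightarrow> ereal L"
proof (rule tendsto_sandwich)
  have ev: "\<forall>\<^sub>F n in sequentially. n > 0 \<and> ereal (l n) \<le> \<beta> n \<and> \<beta> n \<le> ereal (h n)"
    using assms(1) eventually_gt_at_top[of "0::nat"] by eventually_elim blast
  show "\<forall>\<^sub>F n in sequentially. ereal (l n / real n) \<le> \<beta> n / ereal (real n)"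
    using ev by eventually_elim (use ereal_divide_right_mono[of "ereal (l _)" "\<beta> _" "ereal (real _)"] in force)
  show "\<forall>\<^sub>F n in sequentially. \<beta> n / ereal (real n) \<le> ereal (h n / real n)"
    using ev by eventually_elim (use ereal_divide_right_mono[of "\<beta> _" "ereal (h _)" "ereal (real _)"] in force)
qed (use assms(2,3) in auto)

lemma asymptotic_resurgence_eq:
  assumes lim: "(\<lambda>n. beta a B n / ereal (real n)) \<longlonglongrightarrow> ereal L" and "L \<ge> 0"
    and mono: "\<And>d d'. 1 \<le> d \<Longrightarrow> d \<le> d' \<Longrightarrow> B d' \<subseteq> B d"
  shows "1 / asymptotic_resurgence a B = ereal L"
proof -
  define R where "R = {ereal (real s / real r) | s r. s \<ge> 1 \<and> r \<ge> 1 \<and>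
      (\<forall>\<^sub>F t in sequentially. \<not> a (s * t) \<subseteq> B (r * t))}"
  have lim': "(\<lambda>t. beta a B (s * t) / ereal (real (s * t))) \<longlonglongrightarrow> ereal L" if "s \<ge> 1" for s
    using filterlim_compose[OF lim, of "\<lambda>t. s * t" sequentially] that
    by (simp add: mult_nat_left_at_top)
  have upper: "L * (real s / real r) \<le> 1"
    if sr: "s \<ge> 1" "r \<ge> 1" "\<forall>\<^sub>F t in sequentially. \<not> a (s * t) \<subseteq> B (r * t)" for s r
  proof -
    have "\<forall>\<^sub>F t in sequentially. beta a B (s * t) / ereal (real (s * t)) \<le> ereal (real r / real s)"
      using sr(3) eventually_gt_at_top[of 0]
    proof eventually_elim
      case (elim t)
      then have "beta a B (s * t) \<le> ereal (real (r * t))"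
        unfolding beta_def using sr(2) by (intro INF_lower) auto
      then have "beta a B (s * t) / ereal (real (s * t)) \<le> ereal (real (r * t)) / ereal (real (s * t))"
        using elim sr(1) by (intro ereal_divide_right_mono) auto
      then show ?case using elim sr(1) by simp
    qed
    then have "ereal L \<le> ereal (real r / real s)"
      by (rule tendsto_upperbound[OF lim'[OF sr(1)]]) simp
    then show ?thesis using sr(1,2) by (simp add: field_simps)
  qed
  have lower: "ereal (real s / real r) \<in> R" if sr: "s \<ge> 1" "r \<ge> 1" "L < real r / real s" for s r
  proof -
    have "\<forall>\<^sub>F t in sequentially. beta a B (s * t) / ereal (real (s * t)) < ereal (real r / real s)"
      using order_tendstoD(2)[OF lim'[OF sr(1)], of "ereal (real r / real s)"] sr(3) by simp
    then have "\<forall>\<^sub>F t in sequentially. \<not> a (s * t) \<subseteq> B (r * t)"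
      using eventually_gt_at_top[of 0]
    proof eventually_elim
      case (elim t)
      have "beta a B (s * t) < ereal (real (r * t))"
      proof (rule ccontr)
        assume "\<not> ?thesis"
        then have "ereal (real (r * t)) / ereal (real (s * t)) \<le> beta a B (s * t) / ereal (real (s * t))"
          using elim sr(1) by (intro ereal_divide_right_mono) auto
        then show False using elim sr(1) by simp
      qed
      then obtain d where "d \<ge> 1" "\<not> a (s * t) \<subseteq> B d" "d < r * t"
        unfolding beta_def INF_less_iff less_ereal.simps(1) of_nat_less_iff by auto
      then show ?case using mono[of d "r * t"] by auto
    qed
    then show ?thesis using sr unfolding R_def by blast
  qed
  have rho: "asymptotic_resurgence a B = Sup R"
    by (simp add: asymptotic_resurgence_def R_def)
  show ?thesis
  proof (cases "L = 0")
    case True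
    have "ereal x \<le> Sup R" for x
    proof -
      define s where "s = nat \<lceil>\<bar>x\<bar>\<rceil> + 1"
      have "s \<ge> 1" "x \<le> real s" unfolding s_def by linarith+
      moreover have "ereal (real s / real 1) \<in> R"
        by (rule lower) (use True \<open>s \<ge> 1\<close> in auto)
      then have "ereal (real s) \<le> Sup R" by (auto intro: Sup_upper)
      ultimately show ?thesis by (meson ereal_less_eq(3) order_trans)
    qed
    then have "Sup R = \<infinity>" by (rule ereal_top)
    then show ?thesis using True rho by (simp add: zero_ereal_def)
  next
    case False
    then have "L > 0" using \<open>L \<ge> 0\<close> by simp
    have "Sup R = ereal (1 / L)"
    proof (rule antisym)
      show "Sup R \<le> ereal (1 / L)"
        using upper \<open>L > 0\<close> by (intro Sup_least) (auto simp: R_def field_simps)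
      show "ereal (1 / L) \<le> Sup R"
      proof (rule dense_le)
        fix y assume y: "y < ereal (1 / L)"
        \<comment> \<open>\<open>y\<close> may be negative or -\<infinity>; cutting at 0 makes the
          rational \<open>q\<close> positive, hence of the form s / r.\<close>
        define y' where "y' = max 0 (real_of_ereal y)"
        have "y \<noteq> \<infinity>" using y by auto
        then have "y \<le> ereal y'" "y' < 1 / L" using y \<open>L > 0\<close> by (cases y; simp add: y'_def)+
        obtain q where q: "q \<in> \<rat>" "y' < q" "q < 1 / L" using Rats_dense_in_real[OF \<open>y' < 1 / L\<close>] by blast
        then have "q > 0" by (simp add: y'_def)
        obtain s r where sr: "r \<noteq> 0" "\<bar>q\<bar> = real s / real r" using Rats_abs_nat_div_natE[OF q(1)] by blast
        then have "s \<ge> 1" "r \<ge> 1" using \<open>q > 0\<close> by (cases s; simp)+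
        moreover have "L < real r / real s"
        proof -
          have "real s / real r < 1 / L" using q(3) sr(2) \<open>q > 0\<close> by simp
          then show ?thesis using \<open>L > 0\<close> \<open>s \<ge> 1\<close> \<open>r \<ge> 1\<close> by (simp add: field_simps)
        qed
        ultimately have "ereal q \<in> R" using lower[of s r] sr(2) \<open>q > 0\<close> by simp
        then have "ereal q \<le> Sup R" by (rule Sup_upper)
        then show "y \<le> Sup R" using \<open>y \<le> ereal y'\<close> q(2) by (meson ereal_less_eq(3) less_imp_le order_trans)
      qed
    qed
    then show ?thesis using rho \<open>L > 0\<close> by (simp add: one_ereal_def)
  qed
qed

lemma ideal_value_eq:
  assumes "x \<in> A" "x \<noteq> 0" "\<And>y. y \<in> A \<Longrightarrow> y \<noteq> 0 \<Longrightarrow> v (to_fract x) \<le> v (to_fract y)"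
  shows "ideal_value v A = ereal (real_of_int (v (to_fract x)))"
  unfolding ideal_value_def
proof (rule antisym)
  show "(INF y\<in>A - {0}. ereal (real_of_int (v (to_fract y)))) \<le> ereal (real_of_int (v (to_fract x)))"
    using assms(1,2) by (intro INF_lower) auto
  show "ereal (real_of_int (v (to_fract x))) \<le> (INF y\<in>A - {0}. ereal (real_of_int (v (to_fract y))))"
    by (rule INF_greatest) (simp add: assms(3))
qed

section \<open>Filtrations, their Veronese subalgebras and the case of a zero ideal\<close>

lemma beta_closure_ge:
  assumes "filtration b"
  shows "beta a b n \<le> beta a (closure_family b) n"
  unfolding beta_def
proof (rule INF_superset_mono)
  have "b d \<subseteq> closure_family b d" if "d \<ge> 1" for d
    using assms that subset_ideal_integral_closure[of "b d"]
    by (auto simp: filtration_def graded_family_def closure_family_def)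
  then show "{d. 1 \<le> d \<and> \<not> a n \<subseteq> closure_family b d} \<subseteq> {d. 1 \<le> d \<and> \<not> a n \<subseteq> b d}" by blast
qed simp

lemma filtration_antimono:
  assumes "filtration b" "1 \<le> d" "d \<le> d'"
  shows "b d' \<subseteq> b d"
proof -
  have "b (d + i) \<subseteq> b d" for i
  proof (induction i)
    case (Suc i)
    then show ?case using assms(1,2) unfolding filtration_def by (metis Suc_eq_plus1 add_Suc_right order_trans trans_le_add1)
  qed simp
  then show ?thesis using assms(3) by (metis le_add_diff_inverse)
qed

text \<open>\<open>T\<close> consists of the polynomials in t^k whose coefficient at t^(k j) is in
  the j-th power of b k. It is a subring containing the generators, so standard gradedness puts the
  Veronese subalgebra inside it.\<close>

lemma veronese_eq_pow:
  fixes b :: "nat \<Rightarrow> 'a::comm_ring_1 set"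
  assumes ver: "veronese_standard_graded k b" and b: "graded_family b" and k: "k \<ge> 1"
  shows "b (k * m) = ideal_pow (b k) m"
proof
  have id: "is_ideal (b n)" if "n \<ge> 1" for n using b that by (simp add: graded_family_def)
  show "ideal_pow (b k) m \<subseteq> b (k * m)"
  proof (induction m)
    case 0
    then show ?case using b by (simp add: graded_family_def)
  next
    case (Suc m)
    have "x * y \<in> b (k * Suc m)" if "x \<in> b k" "y \<in> ideal_pow (b k) m" for x y
    proof (cases "m = 0")
      case True
      then show ?thesis using ideal_mult_right[OF id[OF k] that(1)] by simp
    next
      case False
      have "ideal_mult (b k) (b (k * m)) \<subseteq> b (k + k * m)"
        using b k False by (simp add: graded_family_def)
      then show ?thesis using mult_in_ideal_mult[of x "b k" y "b (k * m)"] that Suc by auto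
    qed
    then show ?case unfolding ideal_pow.simps using id k by (intro ideal_mult_minimal) auto
  qed
  define T where "T = {p. \<forall>j. coeff p j \<in> (if k dvd j then ideal_pow (b k) (j div k) else {0})}"
  have zero: "0 \<in> ideal_pow (b k) j" for j by (rule ideal_0[OF ideal_ideal_pow])
  have coeff_T: "k dvd j \<Longrightarrow> coeff p j \<in> ideal_pow (b k) (j div k)" "\<not> k dvd j \<Longrightarrow> coeff p j = 0"
    if "p \<in> T" for p j
    using spec[OF that[unfolded T_def mem_Collect_eq], of j] by simp_all
  have "subalgebra_gen {Polynomial.monom c k | c. c \<in> b k} \<subseteq> T"
  proof (rule subalgebra_gen_minimal)
    show "subring T"
      unfolding subring_def
    proof (intro conjI ballI)
      show "1 \<in> T" using zero by (auto simp: T_def coeff_1 simp del: ideal_pow.simps(2))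
      fix p q assume pq: "p \<in> T" "q \<in> T"
      show "p - q \<in> T"
        unfolding T_def
      proof (intro CollectI allI)
        fix j
        show "coeff (p - q) j \<in> (if k dvd j then ideal_pow (b k) (j div k) else {0})"
          using coeff_T[OF pq(1), of j] coeff_T[OF pq(2), of j]
          by (cases "k dvd j") (simp_all add: ideal_diff[OF ideal_ideal_pow])
      qed
      have "coeff p i * coeff q (j - i) \<in> (if k dvd j then ideal_pow (b k) (j div k) else {0})"
        if "i \<le> j" for i j
      proof (cases "k dvd i \<and> k dvd j - i")
        case True
        then obtain u w where "i = k * u" "j - i = k * w" by (auto elim!: dvdE)
        then have "j = k * (u + w)" using that by (simp add: distrib_left)
        then have "k dvd j" "j div k = i div k + (j - i) div k"
          using \<open>i = k * u\<close> \<open>j - i = k * w\<close> k by simp_all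
        then show ?thesis
          using ideal_pow_add_mem[of "coeff p i" "b k" "i div k" "coeff q (j - i)" "(j - i) div k"]
            coeff_T(1)[OF pq(1)] coeff_T(1)[OF pq(2)] True by simp
      next
        case False
        then have "coeff p i * coeff q (j - i) = 0" using coeff_T(2)[OF pq(1)] coeff_T(2)[OF pq(2)] by auto
        then show ?thesis using zero by simp
      qed
      moreover have "is_ideal (if k dvd j then ideal_pow (b k) (j div k) else {0})" for j
        using ideal_ideal_pow module.subspace_single_0[OF module_times] by auto
      ultimately have "coeff (p * q) j \<in> (if k dvd j then ideal_pow (b k) (j div k) else {0})" for j
        unfolding coeff_mult by (intro ideal_sum) auto
      then show "p * q \<in> T" by (simp only: T_def mem_Collect_eq simp_thms)
    qed
    show "[:c:] \<in> T" for c using zero by (auto simp: T_def coeff_pCons split: nat.splits)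
    have "b k = ideal_pow (b k) 1" using ideal_pow_1[OF id[OF k]] by simp
    then show "{Polynomial.monom c k | c. c \<in> b k} \<subseteq> T"
      using zero k by (auto simp: T_def simp del: ideal_pow.simps(2) One_nat_def)
  qed
  then have T: "veronese k b \<subseteq> T" using ver by (simp add: veronese_standard_graded_def)
  show "b (k * m) \<subseteq> ideal_pow (b k) m"
  proof
    fix x assume x: "x \<in> b (k * m)"
    have "0 \<in> b n" for n using ideal_0[OF id[of n]] b by (cases "n = 0") (auto simp: graded_family_def)
    then have "Polynomial.monom x (k * m) \<in> veronese k b" using x by (simp add: veronese_def)
    then have "Polynomial.monom x (k * m) \<in> T" using T by blast
    from coeff_T(1)[OF this, of "k * m"] show "x \<in> ideal_pow (b k) m" using k by simp
  qed
qed

lemma closure_family_antimono: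
  assumes "filtration b" "1 \<le> d" "d \<le> d'"
  shows "closure_family b d' \<subseteq> closure_family b d"
  unfolding closure_family_def
  by (rule ideal_integral_closure_mono[OF filtration_antimono[OF assms]])

text \<open>A nonzero a n is not contained in b k = 0, so all three numbers lie between 0 and k for
  large n. For the zero valuation, a zero ideal has value \<infinity> and any other ideal value
  0.\<close>

lemma resurgence_zero_case:
  fixes a b :: "nat \<Rightarrow> 'a::idom set"
  assumes a: "graded_family a" and b: "filtration b" and nz: "\<forall>\<^sub>F n in sequentially. a n \<noteq> {0}"
    and k: "k \<ge> 1" and bk: "b k = {0}"
  shows "(\<lambda>n. beta a b n / ereal (real n)) \<longlonglongrightarrow> 1 / asymptotic_resurgence a (closure_family b)"
    "(\<lambda>n. beta a (closure_family b) n / ereal (real n)) \<longlonglongrightarrow> 1 / asymptotic_resurgence a (closure_family b)"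
    "(\<lambda>n. beta_val (\<lambda>_. 0) a b n / ereal (real n)) \<longlonglongrightarrow> 1 / asymptotic_resurgence a (closure_family b)"
proof -
  have ev: "\<forall>\<^sub>F n in sequentially. \<exists>x\<in>a n. x \<noteq> 0"
    using nz eventually_ge_at_top[of "1::nat"]
  proof eventually_elim
    case (elim n)
    then have "is_ideal (a n)" using a by (simp add: graded_family_def)
    then show ?case using ideal_nonzero_mem[of "a n"] elim by metis
  qed
  have lim0: "(\<lambda>n. \<beta> n / ereal (real n)) \<longlonglongrightarrow> ereal 0"
    if "\<forall>\<^sub>F n in sequentially. ereal 0 \<le> \<beta> n \<and> \<beta> n \<le> ereal (real k)" for \<beta> :: "nat \<Rightarrow> ereal"
    by (rule tendsto_ereal_quotient[OF that]) (auto intro: lim_const_over_n)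
  have beta: "(\<lambda>n. beta a B n / ereal (real n)) \<longlonglongrightarrow> ereal 0" if "B k = {0}" for B
  proof (rule lim0)
    show "\<forall>\<^sub>F n in sequentially. ereal 0 \<le> beta a B n \<and> beta a B n \<le> ereal (real k)"
      using ev
    proof eventually_elim
      case (elim n)
      then have "\<not> a n \<subseteq> B k" using that by auto
      then show ?case unfolding beta_def using k by (auto intro!: INF_greatest INF_lower)
    qed
  qed
  have cl: "closure_family b k = {0}"
    using ideal_integral_closure_zero[OF bk] by (simp add: closure_family_def)
  have rho: "1 / asymptotic_resurgence a (closure_family b) = ereal 0"
    by (rule asymptotic_resurgence_eq[OF beta[of "closure_family b"]])
      (use cl closure_family_antimono[OF b] in auto)
  show "(\<lambda>n. beta a b n / ereal (real n)) \<longlonglongrightarrow> 1 / asymptotic_resurgence a (closure_family b)"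
    "(\<lambda>n. beta a (closure_family b) n / ereal (real n)) \<longlonglongrightarrow> 1 / asymptotic_resurgence a (closure_family b)"
    unfolding rho by (rule beta[of b, OF bk], rule beta[of "closure_family b", OF cl])
  show "(\<lambda>n. beta_val (\<lambda>_. 0) a b n / ereal (real n)) \<longlonglongrightarrow> 1 / asymptotic_resurgence a (closure_family b)"
    unfolding rho
  proof (rule lim0)
    show "\<forall>\<^sub>F n in sequentially. ereal 0 \<le> beta_val (\<lambda>_. 0) a b n \<and> beta_val (\<lambda>_. 0) a b n \<le> ereal (real k)"
      using ev
    proof eventually_elim
      case (elim n)
      then have "ideal_value (\<lambda>_. 0) (a n) = 0" using ideal_value_eq[of _ "a n" "\<lambda>_. 0"] by (auto simp: zero_ereal_def)
      moreover have "ideal_value (\<lambda>_. 0) (b k) = \<infinity>" by (simp add: ideal_value_def bk top_ereal_def)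
      ultimately show ?case unfolding beta_val_def using k by (auto intro!: INF_greatest INF_lower)
    qed
  qed
qed

text \<open>If a n is zero, \<open>beta a b n\<close> is infinite. If b k is the whole ring, then so
  is every b d with d >= 1; all three numbers are infinite, while the resurgence is
  \<open>Sup {}\<close>, whose reciprocal is 0. The nonvanishing and properness hypotheses exclude
  this. For b k = 0 the zero valuation serves as \<open>v0\<close>.\<close>

theorem theorem5p12:
  fixes a b :: "nat \<Rightarrow> 'a::idom set" and k :: nat
  assumes "noetherian TYPE('a)"
    and "graded_family a" and "filtration b"
    and "\<forall>\<^sub>F n in sequentially. a n \<noteq> {0}"
    and "k \<ge> 1" and "b k \<noteq> UNIV"
    and "veronese_standard_graded k b"
    and "finitely_generated_module (rees_algebra (ideal_pow (b k)))
           (rees_algebra (closure_family (ideal_pow (b k))))"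
  shows "\<exists>v0 :: 'a fract \<Rightarrow> int.
    valuation v0 \<and> (b k \<noteq> {0} \<longrightarrow> rees_valuation (b k) v0) \<and>
    (\<lambda>n. beta a b n / ereal (real n))
      \<longlonglongrightarrow> 1 / asymptotic_resurgence a (closure_family b) \<and>
    (\<lambda>n. beta a (closure_family b) n / ereal (real n))
      \<longlonglongrightarrow> 1 / asymptotic_resurgence a (closure_family b) \<and>
    (\<lambda>n. beta_val v0 a b n / ereal (real n))
      \<longlonglongrightarrow> 1 / asymptotic_resurgence a (closure_family b)"
proof (cases "b k = {0}")
  case True
  have "valuation (\<lambda>_ :: 'a fract. 0)" by (simp add: valuation_def)
  then show ?thesis using resurgence_zero_case[OF assms(2-5) True] True by blast
next
  case False
  define A where "A = b k"
  note k = \<open>k \<ge> 1\<close>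
  have b: "graded_family b" using assms(3) by (simp add: filtration_def)
  have A: "is_ideal A" "A \<noteq> {0}" "A \<noteq> UNIV"
    using b k False assms(6) by (auto simp: graded_family_def A_def)
  have bA: "b (k * m) = ideal_pow A m" for m
    unfolding A_def by (rule veronese_eq_pow[OF assms(7) b k])
  define J where "J n = ideal_integral_closure (ideal_pow A n)" for n
  have J: "J m = closure_family b (k * m)" for m by (simp add: J_def closure_family_def bA)
  have "0 \<in> J n" for n
    unfolding J_def using subset_ideal_integral_closure[OF ideal_ideal_pow] ideal_0[OF ideal_ideal_pow] by blast
  moreover have "closure_family (ideal_pow (b k)) = J" by (auto simp: closure_family_def J_def A_def)
  ultimately obtain c where c: "\<And>n. J (n + c) \<subseteq> ideal_pow A n"
    using closure_shift[of "b k" J] assms(8) unfolding A_def by metis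
  obtain VS and e :: "('a fract \<Rightarrow> int) \<Rightarrow> int" where VS: "finite VS" "VS \<noteq> {}"
    "\<And>v. v \<in> VS \<Longrightarrow> rees_valuation A v" "\<And>v. v \<in> VS \<Longrightarrow> nonneg_valuation v"
    and e: "\<And>v. v \<in> VS \<Longrightarrow> e v > 0" "\<And>v. v \<in> VS \<Longrightarrow> \<exists>a\<in>A. a \<noteq> 0 \<and> v (to_fract a) = e v"
    "\<And>v a. v \<in> VS \<Longrightarrow> a \<in> A \<Longrightarrow> a \<noteq> 0 \<Longrightarrow> e v \<le> v (to_fract a)"
    and J_iff: "\<And>n x. x \<in> J n \<longleftrightarrow> x = 0 \<or> (\<forall>v\<in>VS. v (to_fract x) \<ge> int n * e v)"
  proof -
    obtain VS and e :: "('a fract \<Rightarrow> int) \<Rightarrow> int" where "finite VS" "VS \<noteq> {}"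
      and *: "\<forall>v\<in>VS. rees_valuation A v \<and> nonneg_valuation v \<and> e v > 0 \<and>
        (\<exists>a\<in>A. a \<noteq> 0 \<and> v (to_fract a) = e v) \<and> (\<forall>a\<in>A. a \<noteq> 0 \<longrightarrow> e v \<le> v (to_fract a))"
      and **: "\<forall>n x. x \<in> J n \<longleftrightarrow> x = 0 \<or> (\<forall>v\<in>VS. v (to_fract x) \<ge> int n * e v)"
      using rees_valuations_exist[OF assms(1) A c[unfolded J_def], folded J_def] by (elim exE conjE)
    show thesis by (rule that[of VS e]) (use \<open>finite VS\<close> \<open>VS \<noteq> {}\<close> * ** in blast)+
  qed

  obtain N where N: "N \<ge> 1" "\<And>n. n \<ge> N \<Longrightarrow> a n \<noteq> {0}"
    using assms(4) unfolding eventually_sequentially by (metis le_trans nle_le)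
  have a_ideal: "is_ideal (a n)" if "n \<ge> N" for n
    using assms(2) that N(1) by (auto simp: graded_family_def)
  define is_min where "is_min v n x \<longleftrightarrow> x \<in> a n \<and> x \<noteq> 0 \<and>
    (\<forall>y\<in>a n. y \<noteq> 0 \<longrightarrow> v (to_fract x) \<le> v (to_fract y))" for v :: "'a fract \<Rightarrow> int" and n x
  have "\<exists>x. is_min v n x" if v: "v \<in> VS" and n: "n \<ge> N" for v n
  proof -
    obtain y where y: "y \<in> a n" "y \<noteq> 0" using ideal_nonzero_mem[OF a_ideal[OF n] N(2)[OF n]] .
    show ?thesis by (rule valuation_min[OF VS(4)[OF v] y]) (auto simp: is_min_def)
  qed
  then obtain g where "\<And>v n. v \<in> VS \<Longrightarrow> n \<ge> N \<Longrightarrow> is_min v n (g v n)" by metis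
  then have g: "\<And>v n. v \<in> VS \<Longrightarrow> n \<ge> N \<Longrightarrow> g v n \<in> a n" "\<And>v n. v \<in> VS \<Longrightarrow> n \<ge> N \<Longrightarrow> g v n \<noteq> 0"
    "\<And>v n y. v \<in> VS \<Longrightarrow> n \<ge> N \<Longrightarrow> y \<in> a n \<Longrightarrow> y \<noteq> 0 \<Longrightarrow> v (to_fract (g v n)) \<le> v (to_fract y)"
    unfolding is_min_def by blast+
  define \<alpha> where "\<alpha> v n = real_of_int (v (to_fract (g v n)))" for v n
  have value_a: "ideal_value v (a n) = ereal (\<alpha> v n)" if "v \<in> VS" "n \<ge> N" for v n
    unfolding \<alpha>_def using g that by (intro ideal_value_eq) auto
  have "\<exists>l. l \<ge> 0 \<and> (\<lambda>n. \<alpha> v n / real n) \<longlonglongrightarrow> l" if v: "v \<in> VS" for v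
  proof -
    have "\<alpha> v n \<ge> 0" if "n \<ge> N" for n
      using g(2)[OF v that] VS(4)[OF v] by (simp add: \<alpha>_def nonneg_valuation_def)
    moreover have "\<alpha> v (p + q) \<le> \<alpha> v p + \<alpha> v q" if pq: "p \<ge> N" "q \<ge> N" for p q
    proof -
      have "ideal_mult (a p) (a q) \<subseteq> a (p + q)"
        using assms(2) pq N(1) by (simp add: graded_family_def)
      then have "g v p * g v q \<in> a (p + q)" using g(1)[OF v] pq mult_in_ideal_mult by blast
      have "v (to_fract (g v (p + q))) \<le> v (to_fract (g v p * g v q))"
        by (rule g(3)[OF v]) (use g(2)[OF v] pq \<open>g v p * g v q \<in> a (p + q)\<close> in auto)
      also have "\<dots> = v (to_fract (g v p)) + v (to_fract (g v q))"
        using g(2)[OF v] pq valuationD(1)[of v "to_fract (g v p)" "to_fract (g v q)"] VS(4)[OF v]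
        by (simp add: nonneg_valuation_def)
      finally show ?thesis by (simp add: \<alpha>_def)
    qed
    ultimately show ?thesis using fekete[of N "\<alpha> v"] by metis
  qed
  then obtain \<alpha>' where \<alpha>': "\<And>v. v \<in> VS \<Longrightarrow> \<alpha>' v \<ge> 0" "\<And>v. v \<in> VS \<Longrightarrow> (\<lambda>n. \<alpha> v n / real n) \<longlonglongrightarrow> \<alpha>' v"
    by metis
  \<comment> \<open>The smallest ratio v(a n) / e v decides how deep a n lies among the J m;
    \<open>v0\<close> minimizes the limit of this ratio over n.\<close>
  define L where "L = Min ((\<lambda>v. \<alpha>' v / e v) ` VS)"
  have "L \<in> (\<lambda>v. \<alpha>' v / e v) ` VS" unfolding L_def using VS(1,2) by (intro Min_in) auto
  then obtain v0 where v0: "v0 \<in> VS" "L = \<alpha>' v0 / e v0" by auto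
  have e0: "e v0 > 0" using e(1)[OF v0(1)] .
  have val0: "valuation v0" using VS(4)[OF v0(1)] by (simp add: nonneg_valuation_def)
  have "L \<ge> 0" using v0 \<alpha>'(1)[OF v0(1)] e0 by simp

  \<comment> \<open>For a given n the minimum may be attained at a valuation other than
    \<open>v0\<close>; since \<open>VS\<close> is finite, the minima still converge to L.\<close>
  define \<omega> where "\<omega> n = Min ((\<lambda>v. \<alpha> v n / real n / e v) ` VS)" for n
  have e_nonzero: "real_of_int (e v) \<noteq> 0" if "v \<in> VS" for v using e(1)[OF that] by simp
  have \<omega>_lim: "\<omega> \<longlonglongrightarrow> L"
    unfolding \<omega>_def L_def by (intro tendsto_Min tendsto_divide \<alpha>' tendsto_const VS e_nonzero)
  have v0_lim: "(\<lambda>n. \<alpha> v0 n / real n / e v0) \<longlonglongrightarrow> L"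
    unfolding v0(2) using e0 by (intro tendsto_divide \<alpha>' v0 tendsto_const) auto
  have over_n: "(\<lambda>n. r / real n) \<longlonglongrightarrow> 0" for r by (rule lim_const_over_n)
  \<comment> \<open>\<open>l\<close> and \<open>h\<close> bound both beta sequences,
    \<open>l'\<close> and \<open>h\<close> the one of \<open>v0\<close>. The 1 pays for rounding and
    \<open>c\<close> for the step from closures to powers; both vanish after division by n.\<close>
  define l h l' where "l n = real k * (real n * \<omega> n - 1 - real c)"
    and "h n = real k * (\<alpha> v0 n / e v0 + 1)" and "l' n = real k * (\<alpha> v0 n / e v0 - 1)" for n
  have l_lim: "(\<lambda>n. l n / real n) \<longlonglongrightarrow> real k * L"
  proof (rule Lim_transform_eventually)
    show "(\<lambda>n. real k * (\<omega> n - (1 + real c) / real n)) \<longlonglongrightarrow> real k * L"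
      using tendsto_mult_left[OF tendsto_diff[OF \<omega>_lim over_n[of "1 + real c"]], of "real k"] by simp
    show "\<forall>\<^sub>F n in sequentially. real k * (\<omega> n - (1 + real c) / real n) = l n / real n"
      using eventually_gt_at_top[of 0] by eventually_elim (simp add: l_def field_simps)
  qed
  have h_lim: "(\<lambda>n. h n / real n) \<longlonglongrightarrow> real k * L"
  proof (rule Lim_transform_eventually)
    show "(\<lambda>n. real k * (\<alpha> v0 n / real n / e v0 + 1 / real n)) \<longlonglongrightarrow> real k * L"
      using tendsto_mult_left[OF tendsto_add[OF v0_lim over_n[of 1]], of "real k"] by simp
    show "\<forall>\<^sub>F n in sequentially. real k * (\<alpha> v0 n / real n / e v0 + 1 / real n) = h n / real n"
      using eventually_gt_at_top[of 0] by eventually_elim (use e0 in \<open>simp add: h_def field_simps\<close>)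
  qed
  have l'_lim: "(\<lambda>n. l' n / real n) \<longlonglongrightarrow> real k * L"
  proof (rule Lim_transform_eventually)
    show "(\<lambda>n. real k * (\<alpha> v0 n / real n / e v0 - 1 / real n)) \<longlonglongrightarrow> real k * L"
      using tendsto_mult_left[OF tendsto_diff[OF v0_lim over_n[of 1]], of "real k"] by simp
    show "\<forall>\<^sub>F n in sequentially. real k * (\<alpha> v0 n / real n / e v0 - 1 / real n) = l' n / real n"
      using eventually_gt_at_top[of 0] by eventually_elim (use e0 in \<open>simp add: l'_def field_simps\<close>)
  qed

  \<comment> \<open>d / k rounded up, so that A^(up d) = b (k * up d) is contained in b d for d >=
    1.\<close>
  define up where "up d = (d + k - 1) div k" for d
  have up: "d \<le> k * up d" "real (up d) \<le> real d / real k + 1" for d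
  proof -
    have "d + k - 1 = k * up d + (d + k - 1) mod k" by (simp add: up_def)
    moreover have "(d + k - 1) mod k < k" using k by simp
    ultimately have *: "d \<le> k * up d" "k * up d \<le> d + k" using k by linarith+
    then show "d \<le> k * up d" by blast
    have "real k * real (up d) \<le> real d + real k"
      using *(2) by (metis of_nat_add of_nat_le_iff of_nat_mult)
    then show "real (up d) \<le> real d / real k + 1" using k by (simp add: field_simps)
  qed
  have pow_sub: "ideal_pow A (up d) \<subseteq> b d" if "d \<ge> 1" for d
    using filtration_antimono[OF assms(3) that up(1)] bA by simp
  have lower: "ereal (l n) \<le> beta a b n" if n: "n \<ge> N" for n
    unfolding beta_def
  proof (rule INF_greatest, rule ccontr)
    fix d assume d: "d \<in> {d. 1 \<le> d \<and> \<not> a n \<subseteq> b d}" and "\<not> ereal (l n) \<le> ereal (real d)"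
    then have "real d < real k * (real n * \<omega> n - 1 - real c)" by (simp add: l_def)
    then have "real d / real k < real n * \<omega> n - 1 - real c" using k by (simp add: field_simps)
    then have m: "real (up d + c) \<le> real n * \<omega> n" using up(2)[of d] by simp
    \<comment> \<open>The \<open>c\<close> subtracted in \<open>l\<close> makes room for this: J (up
      d + c) is contained in A^(up d), hence in b d.\<close>
    have "a n \<subseteq> J (up d + c)"
    proof
      fix x assume x: "x \<in> a n"
      have "int (up d + c) * e v \<le> v (to_fract x)" if v: "v \<in> VS" and "x \<noteq> 0" for v
      proof -
        have "\<omega> n \<le> \<alpha> v n / real n / e v" unfolding \<omega>_def using VS(1) v by simp
        then have "real n * \<omega> n \<le> real n * (\<alpha> v n / real n / e v)" by (intro mult_left_mono) auto
        then have "real (up d + c) \<le> \<alpha> v n / e v" using m n N(1) by simp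
        then have "real (up d + c) * real_of_int (e v) \<le> \<alpha> v n" using e(1)[OF v] by (simp add: field_simps)
        then have "int (up d + c) * e v \<le> v (to_fract (g v n))"
          unfolding \<alpha>_def by (metis of_int_le_iff of_int_mult of_int_of_nat_eq)
        also have "\<dots> \<le> v (to_fract x)" using g(3)[OF v n x] that by simp
        finally show ?thesis .
      qed
      then show "x \<in> J (up d + c)" using J_iff by blast
    qed
    then have "a n \<subseteq> b d" using c[of "up d"] pow_sub[of d] d by auto
    then show False using d by blast
  qed
  \<comment> \<open>For n >= N, the least natural number exceeding v0(a n) / e v0, so that an
    element of least value in a n is outside J (m n).\<close>
  define m where "m n = nat \<lfloor>\<alpha> v0 n / e v0\<rfloor> + 1" for n
  have m: "\<alpha> v0 n < real (m n) * e v0" "real (k * m n) \<le> h n" if "n \<ge> N" for n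
  proof -
    have "\<alpha> v0 n \<ge> 0"
      using g(2)[OF v0(1) that] VS(4)[OF v0(1)] by (simp add: \<alpha>_def nonneg_valuation_def)
    then have "\<alpha> v0 n / e v0 \<ge> 0" using e0 by simp
    then have *: "\<alpha> v0 n / e v0 < real (m n)" "real (m n) \<le> \<alpha> v0 n / e v0 + 1"
      unfolding m_def by linarith+
    then show "\<alpha> v0 n < real (m n) * e v0" using e0 by (simp add: field_simps)
    have "real k * real (m n) \<le> h n" unfolding h_def using *(2) by (intro mult_left_mono) auto
    then show "real (k * m n) \<le> h n" by simp
  qed
  have km: "k * m n \<ge> 1" for n using k by (simp add: m_def)
  have upper: "beta a (closure_family b) n \<le> ereal (h n)" if n: "n \<ge> N" for n
  proof -
    have "v0 (to_fract (g v0 n)) < int (m n) * e v0"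
      using m(1)[OF n] unfolding \<alpha>_def by (metis of_int_less_iff of_int_mult of_int_of_nat_eq)
    then have "g v0 n \<notin> J (m n)" using J_iff g(2)[OF v0(1) n] v0(1) by force
    then have "\<not> a n \<subseteq> closure_family b (k * m n)" using g(1)[OF v0(1) n] J by blast
    then have "beta a (closure_family b) n \<le> ereal (real (k * m n))"
      unfolding beta_def using km by (intro INF_lower) auto
    then show ?thesis using m(2)[OF n] by (meson ereal_less_eq(3) order_trans)
  qed
  obtain x0 where x0: "x0 \<in> A" "x0 \<noteq> 0" "v0 (to_fract x0) = e v0" using e(2)[OF v0(1)] by blast
  \<comment> \<open>A power of \<open>x0\<close>, which has the least value on A, lies in b d and
    bounds its value from above.\<close>
  have value_b: "ideal_value v0 (b d) \<le> ereal (real (up d) * e v0)" if "d \<ge> 1" for d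
  proof -
    have "v0 (to_fract (x0 ^ up d)) = int (up d) * e v0"
      using valuation_power[OF val0] x0 by (simp add: to_fract_power)
    moreover have "x0 ^ up d \<in> b d - {0}"
      using power_in_ideal_pow[OF x0(1)] pow_sub[OF that] x0(2) by auto
    then have "ideal_value v0 (b d) \<le> ereal (real_of_int (v0 (to_fract (x0 ^ up d))))"
      unfolding ideal_value_def by (rule INF_lower)
    ultimately show ?thesis by simp
  qed
  have val_lower: "ereal (l' n) \<le> beta_val v0 a b n" if n: "n \<ge> N" for n
    unfolding beta_val_def
  proof (rule INF_greatest)
    fix d assume "d \<in> {d. 1 \<le> d \<and> ideal_value v0 (a n) < ideal_value v0 (b d)}"
    then have "d \<ge> 1" "ereal (\<alpha> v0 n) < ideal_value v0 (b d)" using value_a[OF v0(1) n] by auto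
    then have "ereal (\<alpha> v0 n) < ereal (real (up d) * e v0)" using value_b[of d] less_le_trans by blast
    then have "\<alpha> v0 n / e v0 < real (up d)" using e0 by (simp add: field_simps)
    then have "\<alpha> v0 n / e v0 - 1 \<le> real d / real k" using up(2)[of d] by linarith
    then have "real k * (\<alpha> v0 n / e v0 - 1) \<le> real k * (real d / real k)" by (intro mult_left_mono) auto
    then show "ereal (l' n) \<le> ereal (real d)" using k by (simp add: l'_def)
  qed
  have val_upper: "beta_val v0 a b n \<le> ereal (h n)" if n: "n \<ge> N" for n
  proof -
    have "ereal (real (m n) * e v0) \<le> ideal_value v0 (b (k * m n))"
      unfolding ideal_value_def bA
    proof (rule INF_greatest)
      fix y assume "y \<in> ideal_pow A (m n) - {0}"
      then have "int (m n) * e v0 \<le> v0 (to_fract y)"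
        using valuation_ideal_pow[OF VS(4)[OF v0(1)] e(3)[OF v0(1)], of A "m n"] by auto
      then show "ereal (real (m n) * e v0) \<le> ereal (real_of_int (v0 (to_fract y)))"
        by (metis ereal_less_eq(3) of_int_le_iff of_int_mult of_int_of_nat_eq)
    qed
    then have "ideal_value v0 (a n) < ideal_value v0 (b (k * m n))"
      using m(1)[OF n] value_a[OF v0(1) n] by (metis less_ereal.simps(1) less_le_trans)
    then have "beta_val v0 a b n \<le> ereal (real (k * m n))"
      unfolding beta_val_def using km by (intro INF_lower) auto
    then show ?thesis using m(2)[OF n] by (meson ereal_less_eq(3) order_trans)
  qed
  note ev = eventually_ge_at_top[of N]
  have closure: "(\<lambda>n. beta a (closure_family b) n / ereal (real n)) \<longlonglongrightarrow> ereal (real k * L)"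
    by (rule tendsto_ereal_quotient[OF _ l_lim h_lim], use ev in eventually_elim)
      (use lower upper beta_closure_ge[OF assms(3)] order_trans in blast)
  have rho: "1 / asymptotic_resurgence a (closure_family b) = ereal (real k * L)"
    by (rule asymptotic_resurgence_eq[OF closure]) (use \<open>L \<ge> 0\<close> closure_family_antimono[OF assms(3)] in auto)
  have "(\<lambda>n. beta a b n / ereal (real n)) \<longlonglongrightarrow> ereal (real k * L)"
    by (rule tendsto_ereal_quotient[OF _ l_lim h_lim], use ev in eventually_elim)
      (use lower upper beta_closure_ge[OF assms(3)] order_trans in blast)
  moreover have "(\<lambda>n. beta_val v0 a b n / ereal (real n)) \<longlonglongrightarrow> ereal (real k * L)"
    by (rule tendsto_ereal_quotient[OF _ l'_lim h_lim], use ev in eventually_elim)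
      (use val_lower val_upper in blast)
  ultimately show ?thesis
    unfolding rho using closure val0 VS(3)[OF v0(1)] by (auto simp: A_def)
qed

end
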